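(* Let $K$ be a finite simplicial complex, $d\ge0$, $S_d=S_d(K)$ with $n=\#S_d\ge1$, and let $\Delta_1$ be the signless up 1-Laplacian $\Delta_{1,d}^{up}$ (with adjacency meaning up-neighbours) or the signless down 1-Laplacian $\Delta_{1,d}^{down}$ (with adjacency meaning down-neighbours). Let $\alpha$ be the independence number of $S_d$, $t$ the number of times $1$ appears in the sequence of variational eigenvalues $(c_k)_{k=1}^n$ of $\Delta_1$, $\gamma$ the topological multiplicity of the maximal eigenvalue $1$ of $\Delta_1$, and $\kappa$ the clique covering number of $S_d$. Then $$\alpha\le t\le\gamma\le\kappa .$$
   Context: An abstract simplicial complex $K$ is a family of subsets (faces) of a finite vertex set closed under taking subsets; a $d$-face is a face of cardinality $d+1$, and $S_d(K)$ is the set of $d$-faces (so $S_{-1}(K)=\{\emptyset\}$). Two distinct $d$-faces are up-neighbours if they are contained in a common $(d+1)$-face, and down-neighbours if they share a common $(d-1)$-face. For $t\in\mathbb R$: $\mathrm{Sgn}(t)=\{1\}$ if $t>0$, $\{-1\}$ if $t<0$, $[-1,1]$ if $t=0$, and $\mathrm{Sgn}$ of a vector is the product of the coordinatewise sets. Up case: $B$ is the $0/1$ matrix with rows indexed by $S_{d+1}(K)$, columns by $S_d(K)$, with entry $1$ iff the $d$-face is contained in the $(d+1)$-face, and $\deg_i$ is the number of $(d+1)$-faces containing the $d$-face $i$. Down case: $B$ is the $0/1$ matrix with rows indexed by $S_{d-1}(K)$, columns by $S_d(K)$, with entry $1$ iff the $(d-1)$-face is contained in the $d$-face, and $\deg_i=d+1$.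 All $\deg_i$ are assumed positive. The operator is $\Delta_1 f=\{B^\top g:g\in\mathrm{Sgn}(Bf)\}$, and $(\mu,f)$ with $f\neq0$ is an eigenpair if $\Delta_1f\cap\mu D\,\mathrm{Sgn}(f)\ne\varnothing$, $D=\mathrm{diag}(\deg_i)$. Let $I(f)=\|Bf\|_{\ell^1}$, $\|f\|=\sum_i\deg_i|f_i|$, $X=\{f\in\mathbb R^n:\|f\|=1\}$. For symmetric $T=-T\subset X$, the Krasnoselski genus, denoted here $\mathrm{gen}(T)$, is $0$ if $T=\varnothing$ and otherwise the least $k$ such that there is an odd continuous map $T\to\mathbb S^{k-1}$. Variational eigenvalues: $c_k=\inf_{T\subset X,\,T=-T,\,\mathrm{gen}(T)\ge k}\sup_{f\in T}I(f)$, $k=1,\dots,n$. The topological multiplicity of the eigenvalue $1$ is $\gamma=\mathrm{gen}(\{f\in X: I(f)=1\})$. The independence number $\alpha$ is the largest cardinality of a set of pairwise non-adjacent $d$-faces. A clique is a subset of $S_d$ any two distinct elements of which are adjacent; $\kappa$ is the smallest number of cliques whose union is $S_d$. *)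

theory Defs
  imports "HOL-Analysis.Analysis" "HOL-Library.Extended_Nat"
begin

definition abstract_simplicial_complex :: "'a set set \<Rightarrow> bool" where
  "abstract_simplicial_complex K \<longleftrightarrow>
     finite (\<Union>K) \<and> (\<forall>\<sigma>\<in>K. \<forall>\<tau>. \<tau> \<subseteq> \<sigma> \<longrightarrow> \<tau> \<in> K)"

text \<open>The dimension is an integer so that \<open>faces K (- 1)\<close> is \<open>{{}}\<close> for every nonempty
  complex.\<close>

definition faces :: "'a set set \<Rightarrow> int \<Rightarrow> 'a set set" where
  "faces K d = {\<sigma> \<in> K. int (card \<sigma>) = d + 1}"

datatype direction = Up | Down

fun adjacent :: "direction \<Rightarrow> 'a set set \<Rightarrow> int \<Rightarrow> 'a set \<Rightarrow> 'a set \<Rightarrow> bool" where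
  "adjacent Up K d \<sigma> \<tau> \<longleftrightarrow> \<sigma> \<in> faces K d \<and> \<tau> \<in> faces K d \<and> \<sigma> \<noteq> \<tau> \<and>
     (\<exists>\<rho> \<in> faces K (d + 1). \<sigma> \<subseteq> \<rho> \<and> \<tau> \<subseteq> \<rho>)"
| "adjacent Down K d \<sigma> \<tau> \<longleftrightarrow> \<sigma> \<in> faces K d \<and> \<tau> \<in> faces K d \<and> \<sigma> \<noteq> \<tau> \<and>
     (\<exists>\<rho> \<in> faces K (d - 1). \<rho> \<subseteq> \<sigma> \<and> \<rho> \<subseteq> \<tau>)"

definition independence_number :: "direction \<Rightarrow> 'a set set \<Rightarrow> int \<Rightarrow> nat" where
  "independence_number dir K d =
     Max (card ` {A. A \<subseteq> faces K d \<and> pairwise (\<lambda>\<sigma> \<tau>. \<not> adjacent dir K d \<sigma> \<tau>) A})"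

definition face_clique :: "direction \<Rightarrow> 'a set set \<Rightarrow> int \<Rightarrow> 'a set set \<Rightarrow> bool" where
  "face_clique dir K d Q \<longleftrightarrow> Q \<subseteq> faces K d \<and> pairwise (adjacent dir K d) Q"

definition clique_covering_number :: "direction \<Rightarrow> 'a set set \<Rightarrow> int \<Rightarrow> nat" where
  "clique_covering_number dir K d =
     (LEAST m. \<exists>C. finite C \<and> card C = m \<and> (\<forall>Q\<in>C. face_clique dir K d Q) \<and> \<Union>C = faces K d)"

fun row_faces :: "direction \<Rightarrow> 'a set set \<Rightarrow> int \<Rightarrow> 'a set set" where
  "row_faces Up K d = faces K (d + 1)"
| "row_faces Down K d = faces K (d - 1)"

text \<open>\<open>incidence dir \<rho> \<sigma>\<close> is the entry of the matrix \<open>B\<close> in row \<open>\<rho>\<close> and column \<open>\<sigma>\<close>.\<close>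

fun incidence :: "direction \<Rightarrow> 'a set \<Rightarrow> 'a set \<Rightarrow> real" where
  "incidence Up \<rho> \<sigma> = of_bool (\<sigma> \<subseteq> \<rho>)"
| "incidence Down \<rho> \<sigma> = of_bool (\<rho> \<subseteq> \<sigma>)"

fun deg :: "direction \<Rightarrow> 'a set set \<Rightarrow> int \<Rightarrow> 'a set \<Rightarrow> real" where
  "deg Up K d \<sigma> = real (card {\<rho> \<in> faces K (d + 1). \<sigma> \<subseteq> \<rho>})"
| "deg Down K d \<sigma> = real_of_int (d + 1)"

text \<open>The space \<open>\<real>\<^sup>n\<close> with coordinates indexed by the \<open>d\<close>-faces: real functions vanishing
  off \<open>faces K d\<close>.\<close>

definition face_space :: "'a set set \<Rightarrow> int \<Rightarrow> ('a set \<Rightarrow> real) set" where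
  "face_space K d = {f. \<forall>\<sigma>. \<sigma> \<notin> faces K d \<longrightarrow> f \<sigma> = 0}"

definition inc_apply :: "direction \<Rightarrow> 'a set set \<Rightarrow> int \<Rightarrow> ('a set \<Rightarrow> real) \<Rightarrow> 'a set \<Rightarrow> real" where
  "inc_apply dir K d f \<rho> = (\<Sum>\<sigma>\<in>faces K d. incidence dir \<rho> \<sigma> * f \<sigma>)"

definition Sgn :: "real \<Rightarrow> real set" where
  "Sgn t = (if t > 0 then {1} else if t < 0 then {-1} else {-1..1})"

definition Laplacian1 ::
    "direction \<Rightarrow> 'a set set \<Rightarrow> int \<Rightarrow> ('a set \<Rightarrow> real) \<Rightarrow> ('a set \<Rightarrow> real) set" where
  "Laplacian1 dir K d f =
     {(\<lambda>\<sigma>. if \<sigma> \<in> faces K d then \<Sum>\<rho>\<in>row_faces dir K d. incidence dir \<rho> \<sigma> * g \<rho> else 0) | g.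
        \<forall>\<rho>\<in>row_faces dir K d. g \<rho> \<in> Sgn (inc_apply dir K d f \<rho>)}"

definition eigenpair ::
    "direction \<Rightarrow> 'a set set \<Rightarrow> int \<Rightarrow> real \<Rightarrow> ('a set \<Rightarrow> real) \<Rightarrow> bool" where
  "eigenpair dir K d \<mu> f \<longleftrightarrow> f \<in> face_space K d \<and> f \<noteq> (\<lambda>_. 0) \<and>
     Laplacian1 dir K d f \<inter>
       {(\<lambda>\<sigma>. if \<sigma> \<in> faces K d then \<mu> * (deg dir K d \<sigma> * s \<sigma>) else 0) | s.
          \<forall>\<sigma>\<in>faces K d. s \<sigma> \<in> Sgn (f \<sigma>)} \<noteq> {}"

definition energy :: "direction \<Rightarrow> 'a set set \<Rightarrow> int \<Rightarrow> ('a set \<Rightarrow> real) \<Rightarrow> real" where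
  "energy dir K d f = (\<Sum>\<rho>\<in>row_faces dir K d. \<bar>inc_apply dir K d f \<rho>\<bar>)"

definition deg_norm :: "direction \<Rightarrow> 'a set set \<Rightarrow> int \<Rightarrow> ('a set \<Rightarrow> real) \<Rightarrow> real" where
  "deg_norm dir K d f = (\<Sum>\<sigma>\<in>faces K d. deg dir K d \<sigma> * \<bar>f \<sigma>\<bar>)"

definition unit_sphere :: "direction \<Rightarrow> 'a set set \<Rightarrow> int \<Rightarrow> ('a set \<Rightarrow> real) set" where
  "unit_sphere dir K d = {f \<in> face_space K d. deg_norm dir K d f = 1}"

definition symmetric_set :: "('i \<Rightarrow> real) set \<Rightarrow> bool" where
  "symmetric_set T \<longleftrightarrow> (\<lambda>f i. - f i) ` T = T"

text \<open>On \<open>face_space K d\<close>, which has only finitely many nonzero coordinates, the product topology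
  induces the Euclidean topology. The value is \<open>\<infinity>\<close> if there is no odd map into any sphere, which
  never happens for a symmetric subset of \<open>unit_sphere dir K d\<close>.\<close>

definition genus :: "('i \<Rightarrow> real) set \<Rightarrow> enat" where
  "genus T = (if T = {} then 0 else
     Inf (enat ` {k. k \<ge> 1 \<and>
       (\<exists>h. continuous_map (subtopology (powertop_real UNIV) T) (nsphere (k - 1)) h \<and>
            (\<forall>f\<in>T. h (\<lambda>i. - f i) = (\<lambda>j. - h f j)))}))"

definition variational_eigenvalue :: "direction \<Rightarrow> 'a set set \<Rightarrow> int \<Rightarrow> nat \<Rightarrow> real" where
  "variational_eigenvalue dir K d k =
     (INF T \<in> {T. T \<subseteq> unit_sphere dir K d \<and> symmetric_set T \<and> genus T \<ge> enat k}.
        SUP f \<in> T. energy dir K d f)"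

definition variational_multiplicity :: "direction \<Rightarrow> 'a set set \<Rightarrow> int \<Rightarrow> real \<Rightarrow> nat" where
  "variational_multiplicity dir K d \<mu> =
     card {k \<in> {1..card (faces K d)}. variational_eigenvalue dir K d k = \<mu>}"

definition topological_multiplicity :: "direction \<Rightarrow> 'a set set \<Rightarrow> int \<Rightarrow> real \<Rightarrow> enat" where
  "topological_multiplicity dir K d \<mu> = genus {f \<in> unit_sphere dir K d. energy dir K d f = \<mu>}"

lemma finite_faces:
  assumes "abstract_simplicial_complex K"
  shows "finite (faces K d)"
proof -
  have "faces K d \<subseteq> Pow (\<Union>K)" by (auto simp: faces_def)
  with assms show ?thesis
    by (meson abstract_simplicial_complex_def finite_Pow_iff finite_subset)
qed

lemma finite_row_faces:
  assumes "abstract_simplicial_complex K"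
  shows "finite (row_faces dir K d)"
  using assms by (cases dir) (auto intro: finite_faces)

lemma incidence_nonneg: "incidence dir \<rho> \<sigma> \<ge> 0"
  by (cases dir) auto

lemma column_sum:
  assumes K: "abstract_simplicial_complex K" and d: "d \<ge> 0" and \<sigma>: "\<sigma> \<in> faces K d"
  shows "(\<Sum>\<rho>\<in>row_faces dir K d. incidence dir \<rho> \<sigma>) = deg dir K d \<sigma>"
proof (cases dir)
  case Up
  then show ?thesis
    using finite_faces[OF K, of "d + 1"] by (simp add: Int_def)
next
  case Down
  have fin: "finite \<sigma>" and card: "card \<sigma> = Suc (nat d)"
    using \<sigma> d card_ge_0_finite[of \<sigma>] by (auto simp: faces_def)
  have "{\<rho> \<in> faces K (d - 1). \<rho> \<subseteq> \<sigma>} = {\<rho>. \<rho> \<subseteq> \<sigma> \<and> card \<rho> = nat d}"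
    using K \<sigma> d by (auto simp: faces_def abstract_simplicial_complex_def)
  then have "card {\<rho> \<in> faces K (d - 1). \<rho> \<subseteq> \<sigma>} = Suc (nat d)"
    using n_subsets[OF fin, of "nat d"] card by simp
  then show ?thesis
    using Down d finite_faces[OF K, of "d - 1"] by (simp add: Int_def)
qed

lemma energy_le_deg_norm:
  assumes K: "abstract_simplicial_complex K" and d: "d \<ge> 0"
  shows "energy dir K d f \<le> deg_norm dir K d f"
proof -
  have "energy dir K d f
      \<le> (\<Sum>\<rho>\<in>row_faces dir K d. \<Sum>\<sigma>\<in>faces K d. \<bar>incidence dir \<rho> \<sigma> * f \<sigma>\<bar>)"
    unfolding energy_def inc_apply_def by (intro sum_mono sum_abs)
  also have "\<dots> = (\<Sum>\<sigma>\<in>faces K d. \<Sum>\<rho>\<in>row_faces dir K d. \<bar>incidence dir \<rho> \<sigma> * f \<sigma>\<bar>)"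
    by (rule sum.swap)
  also have "\<dots> = (\<Sum>\<sigma>\<in>faces K d. (\<Sum>\<rho>\<in>row_faces dir K d. incidence dir \<rho> \<sigma>) * \<bar>f \<sigma>\<bar>)"
    by (simp add: abs_mult incidence_nonneg sum_distrib_right)
  also have "\<dots> = deg_norm dir K d f"
    unfolding deg_norm_def using column_sum[OF K d] by (intro sum.cong) auto
  finally show ?thesis .
qed

lemma mult_Sgn: "s \<in> Sgn t \<Longrightarrow> t * s = \<bar>t\<bar>"
  by (auto simp: Sgn_def split: if_splits)

lemma eigenpair_energy:
  assumes "eigenpair dir K d \<mu> f"
  shows "energy dir K d f = \<mu> * deg_norm dir K d f"
proof -
  obtain g s where g: "\<forall>\<rho>\<in>row_faces dir K d. g \<rho> \<in> Sgn (inc_apply dir K d f \<rho>)"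
    and s: "\<forall>\<sigma>\<in>faces K d. s \<sigma> \<in> Sgn (f \<sigma>)"
    and eq: "(\<lambda>\<sigma>. if \<sigma> \<in> faces K d then \<Sum>\<rho>\<in>row_faces dir K d. incidence dir \<rho> \<sigma> * g \<rho> else 0)
      = (\<lambda>\<sigma>. if \<sigma> \<in> faces K d then \<mu> * (deg dir K d \<sigma> * s \<sigma>) else 0)"
    using assms unfolding eigenpair_def Laplacian1_def by blast
  have eq': "(\<Sum>\<rho>\<in>row_faces dir K d. incidence dir \<rho> \<sigma> * g \<rho>) = \<mu> * (deg dir K d \<sigma> * s \<sigma>)"
    if "\<sigma> \<in> faces K d" for \<sigma>
    using fun_cong[OF eq, of \<sigma>] that by simp
  have "energy dir K d f = (\<Sum>\<rho>\<in>row_faces dir K d. inc_apply dir K d f \<rho> * g \<rho>)"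
    unfolding energy_def by (intro sum.cong) (use g mult_Sgn in fastforce)+
  also have "\<dots> = (\<Sum>\<rho>\<in>row_faces dir K d. \<Sum>\<sigma>\<in>faces K d. f \<sigma> * (incidence dir \<rho> \<sigma> * g \<rho>))"
    by (simp add: inc_apply_def sum_distrib_left sum_distrib_right mult_ac)
  also have "\<dots> = (\<Sum>\<sigma>\<in>faces K d. f \<sigma> * (\<Sum>\<rho>\<in>row_faces dir K d. incidence dir \<rho> \<sigma> * g \<rho>))"
    by (subst sum.swap) (simp add: sum_distrib_left)
  also have "\<dots> = (\<Sum>\<sigma>\<in>faces K d. \<mu> * (deg dir K d \<sigma> * (f \<sigma> * s \<sigma>)))"
    by (intro sum.cong refl) (simp only: eq' mult.left_commute)
  also have "\<dots> = (\<Sum>\<sigma>\<in>faces K d. \<mu> * (deg dir K d \<sigma> * \<bar>f \<sigma>\<bar>))"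
    by (intro sum.cong) (use s mult_Sgn in fastforce)+
  also have "\<dots> = \<mu> * deg_norm dir K d f"
    by (simp add: deg_norm_def sum_distrib_left)
  finally show ?thesis .
qed

lemma deg_norm_pos:
  assumes K: "abstract_simplicial_complex K" and deg: "\<forall>\<sigma>\<in>faces K d. deg dir K d \<sigma> > 0"
    and f: "f \<in> face_space K d" "f \<noteq> (\<lambda>_. 0)"
  shows "deg_norm dir K d f > 0"
proof -
  obtain \<sigma> where \<sigma>: "\<sigma> \<in> faces K d" "f \<sigma> \<noteq> 0"
    using f by (auto simp: face_space_def fun_eq_iff)
  then show ?thesis
    unfolding deg_norm_def using deg finite_faces[OF K]
    by (intro sum_pos2[of _ \<sigma>]) (auto simp: less_imp_le)
qed

lemma maximal_eigenvalue:
  assumes K: "abstract_simplicial_complex K" and d: "d \<ge> 0" and ne: "faces K d \<noteq> {}"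
    and deg: "\<forall>\<sigma>\<in>faces K d. deg dir K d \<sigma> > 0"
  shows "\<exists>f. eigenpair dir K d 1 f" and "eigenpair dir K d \<mu> f \<Longrightarrow> \<mu> \<le> 1"
proof -
  obtain \<sigma> where \<sigma>: "\<sigma> \<in> faces K d" using ne by blast
  define f where "f = (\<lambda>\<tau>. of_bool (\<tau> = \<sigma>) :: real)"
  define g where "g = (\<lambda>\<rho>. incidence dir \<rho> \<sigma>)"
  define h where "h = (\<lambda>\<tau>. \<Sum>\<rho>\<in>row_faces dir K d. incidence dir \<rho> \<tau> * g \<rho>)"
  define s where "s = (\<lambda>\<tau>. h \<tau> / deg dir K d \<tau>)"
  have Bf: "inc_apply dir K d f \<rho> = incidence dir \<rho> \<sigma>" for \<rho>
    using \<sigma> finite_faces[OF K, of d] by (simp add: inc_apply_def f_def)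
  have "g \<rho> \<in> Sgn (inc_apply dir K d f \<rho>)" for \<rho>
    unfolding Bf g_def by (cases dir) (auto simp: Sgn_def)
  then have in_L: "(\<lambda>\<tau>. if \<tau> \<in> faces K d then h \<tau> else 0) \<in> Laplacian1 dir K d f"
    unfolding Laplacian1_def h_def by blast
  have g01: "0 \<le> g \<rho>" "g \<rho> \<le> 1" for \<rho>
    unfolding g_def by (cases dir; simp)+
  have "s \<tau> \<in> Sgn (f \<tau>)" if \<tau>: "\<tau> \<in> faces K d" for \<tau>
  proof -
    have pos: "deg dir K d \<tau> > 0" using deg \<tau> by blast
    have "0 \<le> h \<tau>"
      unfolding h_def using g01 incidence_nonneg by (intro sum_nonneg mult_nonneg_nonneg)
    moreover have "h \<tau> \<le> deg dir K d \<tau>"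
      unfolding h_def column_sum[OF K d \<tau>, symmetric] using g01 incidence_nonneg
      by (intro sum_mono mult_left_le)
    ultimately have "0 \<le> s \<tau>" "s \<tau> \<le> 1" using pos by (simp_all add: s_def)
    moreover have "s \<tau> = 1" if "\<tau> = \<sigma>"
    proof -
      have sq: "incidence dir \<rho> \<sigma> * incidence dir \<rho> \<sigma> = incidence dir \<rho> \<sigma>" for \<rho>
        by (cases dir) auto
      have "h \<sigma> = deg dir K d \<sigma>"
        by (simp only: h_def g_def sq column_sum[OF K d \<sigma>])
      then show ?thesis using that pos by (simp add: s_def)
    qed
    ultimately show ?thesis by (auto simp: Sgn_def f_def)
  qed
  moreover have "(\<lambda>\<tau>. if \<tau> \<in> faces K d then h \<tau> else 0)
      = (\<lambda>\<tau>. if \<tau> \<in> faces K d then 1 * (deg dir K d \<tau> * s \<tau>) else 0)"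
    using deg by (force simp: s_def fun_eq_iff)
  ultimately have "Laplacian1 dir K d f \<inter>
       {(\<lambda>\<sigma>. if \<sigma> \<in> faces K d then 1 * (deg dir K d \<sigma> * s \<sigma>) else 0) | s.
          \<forall>\<sigma>\<in>faces K d. s \<sigma> \<in> Sgn (f \<sigma>)} \<noteq> {}"
    using in_L by blast
  moreover have "f \<in> face_space K d" "f \<noteq> (\<lambda>_. 0)"
    using \<sigma> by (auto simp: face_space_def f_def fun_eq_iff)
  ultimately show "\<exists>f. eigenpair dir K d 1 f"
    unfolding eigenpair_def by blast
next
  assume f: "eigenpair dir K d \<mu> f"
  then have "deg_norm dir K d f > 0"
    using deg_norm_pos[OF K deg] by (simp add: eigenpair_def)
  moreover have "\<mu> * deg_norm dir K d f \<le> 1 * deg_norm dir K d f"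
    using eigenpair_energy[OF f] energy_le_deg_norm[OF K d, of dir f] by simp
  ultimately show "\<mu> \<le> 1" by (meson mult_le_cancel_right_pos)
qed

end

theory Submission
  imports "HOL-Homology.Simplices" Defs
begin

text \<open>The three inequalities rest on one analytic observation. On the unit sphere the energy
  \<open>\<parallel>Bf\<parallel>\<^sub>1\<close> is at most 1, and it equals 1 iff the triangle inequality is an equality in every row of
  \<open>B\<close>, that is, iff \<open>f\<close> has weakly equal signs on any two adjacent faces. A function supported on an
  independent set therefore has energy 1 (\<open>energy_eq_1_on_independent\<close>), and on a clique
  a function of energy 1 does not change sign (\<open>adjacent_same_sign\<close>).

  The genus of a set is at most \<open>k\<close> iff there are \<open>k\<close> odd continuous real functions without common
  zero on it (\<open>genus_le_iff\<close>). For \<open>\<gamma> \<le> \<kappa>\<close> such functions on the maximum set of the energy are the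
  sums of \<open>f\<close> over the cliques of a cover (\<open>genus_le_clique_cover\<close>). For \<open>\<alpha> \<le> t\<close>, a set on which the
  \<open>n - \<alpha>\<close> coordinates off an independent set have no common zero has genus at most \<open>n - \<alpha>\<close>; a set
  of larger genus thus contains a point of energy 1
  (\<open>independent_le_variational_multiplicity\<close>). For \<open>t \<le> \<gamma>\<close>, extend \<open>\<gamma>\<close> odd functions without common
  zero on the maximum set to the whole sphere. Their zero set is compact, its energy is bounded away
  from 1, and its genus is at least \<open>n - \<gamma>\<close>, so the first \<open>n - \<gamma>\<close> variational eigenvalues are less
  than 1 (\<open>variational_multiplicity_le_genus\<close>).

  The arguments for \<open>t\<close> need that the genus of the sphere is at least \<open>n\<close>, which is the
  Borsuk-Ulam theorem (\<open>Borsuk_Ulam_octa_sphere\<close>). It is derived from Ky Fan's combinatorial lemma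
  on antipodal labellings (\<open>Fan_lemma\<close>). Instead of a symmetric triangulation of the sphere, the proof
  uses singular chains: hemispheres of the cross-polytope, subdivided barycentrically until no
  simplex carries two complementary labels.\<close>

section \<open>Alternating label lists\<close>

primrec alternates :: "bool \<Rightarrow> bool list \<Rightarrow> bool" where
  "alternates s [] \<longleftrightarrow> True"
| "alternates s (x # xs) \<longleftrightarrow> x = s \<and> alternates (\<not> s) xs"

definition delete_nth :: "nat \<Rightarrow> 'b list \<Rightarrow> 'b list" where
  "delete_nth i xs = take i xs @ drop (Suc i) xs"

lemma delete_nth_Cons_0 [simp]: "delete_nth 0 (x # xs) = xs"
  and delete_nth_Cons_Suc [simp]: "delete_nth (Suc i) (x # xs) = x # delete_nth i xs"
  by (simp_all add: delete_nth_def)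

lemma map_delete_nth: "map f (delete_nth i xs) = delete_nth i (map f xs)"
  by (simp add: delete_nth_def take_map drop_map)

lemma mset_delete_nth: "i < length xs \<Longrightarrow> mset (delete_nth i xs) = mset xs - {#xs ! i#}"
  by (subst (2) id_take_nth_drop[of i xs]) (simp_all add: delete_nth_def)

lemma sorted_delete_nth:
  fixes xs :: "'b::linorder list"
  shows "sorted xs \<Longrightarrow> sorted (delete_nth i xs)"
  by (induction xs arbitrary: i; case_tac i)
    (auto simp: delete_nth_def dest: in_set_takeD in_set_dropD)

lemma alternates_Not: "alternates s (map Not w) = alternates (\<not> s) w"
  by (induction w arbitrary: s) auto

text \<open>Induction on the word. Deleting the head leaves the tail; deleting a later letter keeps the
  head, so it contributes only if the head is \<open>s\<close>, and then the induction hypothesis counts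
  the deletions in the tail that alternate starting with \<open>\<not> s\<close>.\<close>

lemma alternating_facets_parity:
  "even ((\<Sum>i<length w. of_bool (alternates s (delete_nth i w)))
      + of_bool (alternates True w) + (of_bool (alternates False w) :: int))"
proof (induction w arbitrary: s)
  case (Cons x xs)
  show ?case
  proof (cases "x = s")
    case True
    have "even ((\<Sum>i<length xs. of_bool (alternates (\<not> s) (delete_nth i xs)))
      + of_bool (alternates True xs) + (of_bool (alternates False xs) :: int))"
      by (rule Cons.IH)
    with True show ?thesis
      by (cases s) (auto simp: sum.lessThan_Suc_shift simp del: sum.lessThan_Suc)
  next
    case False
    then show ?thesis
      by (cases s) (auto simp: sum.lessThan_Suc_shift simp del: sum.lessThan_Suc)
  qed
qed auto

text \<open>The signed labels \<open>+j\<close> and \<open>-j\<close> are coded as the numbers \<open>2 * j\<close> and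
  \<open>2 * j + 1\<close>. The usual order of the codes is then the order by absolute value, which is all
  that Fan's counting needs, and the sign is the parity of the code.\<close>

definition flip_label :: "nat \<Rightarrow> nat" where
  "flip_label c = (if even c then Suc c else c - 1)"

lemma even_flip_label [simp]: "even (flip_label c) \<longleftrightarrow> odd c"
  and flip_label_div_2 [simp]: "flip_label c div 2 = c div 2"
  by (auto simp: flip_label_def elim: oddE)

text \<open>Negating all labels keeps their order by absolute value; only a complementary pair is
  swapped.\<close>

lemma flip_label_mono:
  assumes "c \<le> c'" "flip_label c \<noteq> c'"
  shows "flip_label c \<le> flip_label c'"
  using assms by (cases "even c"; cases "even c'") (auto simp: flip_label_def elim!: evenE oddE)

definition uncomplemented :: "nat set \<Rightarrow> bool" where
  "uncomplemented L \<longleftrightarrow> (\<forall>c\<in>L. flip_label c \<notin> L)"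

text \<open>Fan's indicator of an alternating simplex: listed by increasing absolute value, the labels have
  the signs \<open>+, -, +, -, \<dots>\<close>. It depends only on the multiset of labels, so the order of the
  vertices in a singular simplex is irrelevant.\<close>

definition fan :: "nat list \<Rightarrow> int" where
  "fan cs = of_bool (alternates True (map even (sort cs)))"

lemma sort_map_flip_label:
  assumes "uncomplemented (set cs)"
  shows "sort (map flip_label cs) = map flip_label (sort cs)"
proof (rule properties_for_sort)
  have "sorted_wrt (\<le>) (map flip_label ys)" if "sorted ys" "uncomplemented (set ys)" for ys
    unfolding sorted_wrt_map
    by (rule sorted_wrt_mono_rel[OF _ that(1)])
      (use that(2) in \<open>metis flip_label_mono uncomplemented_def\<close>)
  then show "sorted (map flip_label (sort cs))"
    using assms by simp
qed simp

lemma fan_map_flip_label: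
  assumes "uncomplemented (set cs)"
  shows "fan (map flip_label cs) = of_bool (alternates False (map even (sort cs)))"
proof -
  have "map even (map flip_label ys) = map Not (map even ys)" for ys
    by simp
  then show ?thesis
    unfolding fan_def sort_map_flip_label[OF assms]
    using alternates_Not[of True "map even (sort cs)"] by metis
qed

text \<open>Sorting permutes the facets, and a sum over all facets does not see this permutation.\<close>

lemma sum_delete_nth_sort:
  fixes G :: "nat list \<Rightarrow> int"
  shows "(\<Sum>i<length cs. G (sort (delete_nth i cs)))
    = (\<Sum>i<length cs. G (delete_nth i (sort cs)))"
proof -
  \<comment> \<open>Both sums only see the multiset of labels, as a sum over its elements.\<close>
  define H where "H = (\<lambda>M c. G (sorted_list_of_multiset (M - {#c#})))"
  have *: "(\<Sum>i<length ds. G (sort (delete_nth i ds))) = sum_mset (image_mset (H (mset ds)) (mset ds))" for ds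
  proof -
    have "(\<Sum>i<length ds. G (sort (delete_nth i ds))) = (\<Sum>i<length ds. H (mset ds) (ds ! i))"
      by (intro sum.cong) (simp_all add: H_def flip: mset_delete_nth)
    also have "\<dots> = sum_list (map (H (mset ds)) ds)"
      by (simp add: sum_list_sum_nth atLeast0LessThan)
    also have "\<dots> = sum_mset (image_mset (H (mset ds)) (mset ds))"
      by (metis mset_map sum_mset_sum_list)
    finally show ?thesis .
  qed
  have "(\<Sum>i<length cs. G (sort (delete_nth i cs))) = (\<Sum>i<length (sort cs). G (sort (delete_nth i (sort cs))))"
    unfolding * by simp
  also have "\<dots> = (\<Sum>i<length cs. G (delete_nth i (sort cs)))"
    by (intro sum.cong) (simp_all add: sorted_delete_nth sorted_sort_id)
  finally show ?thesis .
qed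

text \<open>Fan's identity modulo 2: the number of facets alternating from \<open>+\<close> is odd exactly if the
  simplex alternates from \<open>+\<close> or from \<open>-\<close>. Alternating from \<open>-\<close> means that the
  antipodal simplex alternates from \<open>+\<close>.\<close>

lemma fan_facets_parity:
  assumes "uncomplemented (set cs)"
  shows "even ((\<Sum>i<length cs. fan (delete_nth i cs)) + fan cs + fan (map flip_label cs))"
proof -
  have "(\<Sum>i<length cs. fan (delete_nth i cs))
      = (\<Sum>i<length cs. of_bool (alternates True (map even (delete_nth i (sort cs)))))"
    unfolding fan_def by (rule sum_delete_nth_sort)
  then show ?thesis
    using alternating_facets_parity[of True "map even (sort cs)"]
    unfolding fan_map_flip_label[OF assms] by (simp add: fan_def map_delete_nth)
qed

text \<open>An alternating simplex without complementary labels has labels of distinct absolute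
  values: equal neighbours in the sorted list would have equal or complementary labels.\<close>

lemma fan_eq_0:
  assumes "uncomplemented (set cs)" "set cs \<subseteq> {..<2 * m}" "m < length cs"
  shows "fan cs = 0"
proof (rule ccontr)
  assume "fan cs \<noteq> 0"
  then have alt: "alternates True (map even (sort cs))"
    by (simp add: fan_def)
  have "sorted_wrt (<) (map (\<lambda>c. c div 2) ys)"
    if "sorted ys" "uncomplemented (set ys)" "alternates s (map even ys)" for s ys
    using that
  proof (induction ys arbitrary: s rule: induct_list012)
    case (3 y z zs)
    have "y div 2 < z div 2"
    proof -
      have "y \<le> z" "even y \<noteq> even z" "flip_label y \<noteq> z"
        using 3 by (auto simp: uncomplemented_def)
      then show ?thesis
        by (cases "even y"; cases "even z") (auto simp: flip_label_def elim!: evenE oddE)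
    qed
    moreover have "sorted_wrt (<) (map (\<lambda>c. c div 2) (z # zs))"
      by (rule "3.IH"(2)[of "\<not> s"]) (use "3.prems" in \<open>auto simp: uncomplemented_def\<close>)
    ultimately show ?case
      by simp (meson order.strict_trans)
  qed auto
  from this[of "sort cs"] have "distinct (map (\<lambda>c. c div 2) (sort cs))"
    using alt assms(1) strict_sorted_iff by fastforce
  then have "length cs = card (set (map (\<lambda>c. c div 2) (sort cs)))"
    by (metis distinct_card length_map length_sort)
  also have "\<dots> \<le> card {..<m}"
    by (intro card_mono) (use assms(2) in auto)
  finally show False using assms(3) by simp
qed

section \<open>Hemispheres of the cross-polytope as singular chains\<close>

abbreviation antipode :: "('i \<Rightarrow> real) \<Rightarrow> 'i \<Rightarrow> real" where
  "antipode x \<equiv> \<lambda>i. - x i"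

text \<open>The boundary of the cross-polytope in \<open>\<real>\<^sup>n\<close>. The \<open>\<ell>\<^sup>1\<close> norm is additive on disjoint
  supports, so the segments from \<open>basis_point p\<close> to the points of \<open>octa_sphere p\<close> lie in
  \<open>octa_sphere (Suc p)\<close>: coning with straight simplices stays on this sphere, which it would not
  do on a round one.\<close>

definition octa_sphere :: "nat \<Rightarrow> (nat \<Rightarrow> real) set" where
  "octa_sphere n = {x. (\<forall>i\<ge>n. x i = 0) \<and> (\<Sum>i<n. \<bar>x i\<bar>) = 1}"

definition basis_point :: "nat \<Rightarrow> nat \<Rightarrow> real" where
  "basis_point i = (\<lambda>j. if j = i then 1 else 0)"

text \<open>The sign is the one that turns a hemisphere into a cycle: the antipodal map of the
  \<open>p\<close>-sphere has degree \<open>(-1) ^ Suc p\<close>.\<close>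

definition antipodal_cycle :: "nat \<Rightarrow> (nat \<Rightarrow> real) chain \<Rightarrow> (nat \<Rightarrow> real) chain" where
  "antipodal_cycle p c = c + frag_cmul ((-1) ^ Suc p) (chain_map p antipode c)"

text \<open>\<open>octa_chain p\<close> is a hemisphere of the \<open>p\<close>-dimensional cross-polytope boundary: the
  cone over the equator, which is the union of the next lower hemisphere and its antipode.\<close>

primrec octa_chain :: "nat \<Rightarrow> (nat \<Rightarrow> real) chain" where
  "octa_chain 0 = frag_of (\<lambda>u\<in>standard_simplex 0. basis_point 0)"
| "octa_chain (Suc p) = simplicial_cone p (basis_point (Suc p)) (antipodal_cycle p (octa_chain p))"

lemma antipode_octa_sphere: "x \<in> octa_sphere n \<Longrightarrow> antipode x \<in> octa_sphere n"
  by (simp add: octa_sphere_def)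

lemma octa_sphere_mono:
  assumes "p \<le> n" shows "octa_sphere p \<subseteq> octa_sphere n"
proof
  fix x assume x: "x \<in> octa_sphere p"
  then have "(\<Sum>i<n. \<bar>x i\<bar>) = (\<Sum>i<p. \<bar>x i\<bar>)"
    using assms by (intro sum.mono_neutral_right) (auto simp: octa_sphere_def)
  then show "x \<in> octa_sphere n"
    using x assms by (auto simp: octa_sphere_def)
qed

lemma simplicial_chain_antipode:
  assumes "simplicial_chain p (octa_sphere n) c"
  shows "simplicial_chain p (octa_sphere n) (chain_map p antipode c)"
  using assms unfolding simplicial_chain_def
proof (induction c rule: frag_induction)
  case (one f)
  then obtain l where l: "f = oriented_simplex p l" and im: "f ` standard_simplex p \<subseteq> octa_sphere n"
    by (auto simp: simplicial_simplex)
  have "simplex_map p antipode f = oriented_simplex p (\<lambda>j. antipode (l j))"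
    by (auto simp: simplex_map_def oriented_simplex_def l sum_negf)
  moreover have "simplex_map p antipode f ` standard_simplex p \<subseteq> octa_sphere n"
    using im antipode_octa_sphere by (force simp: simplex_map_def)
  ultimately show ?case
    by (auto simp: simplicial_simplex)
next
  case (diff a b)
  then show ?case
    by (metis chain_map_diff simplicial_chain_def simplicial_chain_diff)
qed auto

lemma simplicial_chain_antipodal_cycle:
  assumes "simplicial_chain p (octa_sphere n) c"
  shows "simplicial_chain p (octa_sphere n) (antipodal_cycle p c)"
proof -
  have "antipodal_cycle p c = c - frag_cmul ((-1) ^ p) (chain_map p antipode c)"
    by (simp add: antipodal_cycle_def)
  then show ?thesis
    using assms by (simp add: simplicial_chain_diff simplicial_chain_cmul simplicial_chain_antipode)
qed

lemma simplicial_chain_octa_chain: "simplicial_chain p (octa_sphere (Suc p)) (octa_chain p)"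
proof (induction p)
  case 0
  have "(\<lambda>u\<in>standard_simplex 0. basis_point 0) = oriented_simplex 0 (\<lambda>_. basis_point 0)"
    by (auto simp: oriented_simplex_def standard_simplex_0)
  moreover have "(\<lambda>u\<in>standard_simplex 0. basis_point 0) ` standard_simplex 0 \<subseteq> octa_sphere (Suc 0)"
    by (auto simp: octa_sphere_def basis_point_def)
  ultimately have "simplicial_simplex 0 (octa_sphere (Suc 0)) (\<lambda>u\<in>standard_simplex 0. basis_point 0)"
    unfolding simplicial_simplex by blast
  then show ?case by simp
next
  case (Suc p)
  show ?case
    unfolding octa_chain.simps
  proof (rule simplicial_chain_simplicial_cone)
    show "simplicial_chain p (octa_sphere (Suc p)) (antipodal_cycle p (octa_chain p))"
      by (rule simplicial_chain_antipodal_cycle[OF Suc.IH])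
    fix x :: "nat \<Rightarrow> real" and u :: real
    assume u: "0 \<le> u" "u \<le> 1" and x: "x \<in> octa_sphere (Suc p)"
    have "(\<Sum>i<Suc p. \<bar>(1 - u) * basis_point (Suc p) i + u * x i\<bar>) = (\<Sum>i<Suc p. u * \<bar>x i\<bar>)"
      using u by (intro sum.cong) (auto simp: basis_point_def abs_mult)
    also have "\<dots> = u"
      using x by (simp add: octa_sphere_def flip: sum_distrib_left del: sum.lessThan_Suc)
    finally show "(\<lambda>i. (1 - u) * basis_point (Suc p) i + u * x i) \<in> octa_sphere (Suc (Suc p))"
      using u x by (auto simp: octa_sphere_def basis_point_def)
  qed
qed

text \<open>The boundary of a cone over a cycle is that cycle, so the content is that every equator is a
  cycle: the boundary of a hemisphere is an equator of one dimension less, which the antipodal map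
  preserves up to sign, and the sign makes it cancel against the boundary of the antipodal
  hemisphere.\<close>

lemma chain_boundary_octa_chain:
  "chain_boundary (Suc p) (octa_chain (Suc p)) = antipodal_cycle p (octa_chain p)"
proof (induction p)
  case 0
  have "simplex_map 0 antipode (\<lambda>u\<in>standard_simplex 0. basis_point 0)
      = (\<lambda>u\<in>standard_simplex 0. antipode (basis_point 0))"
    by (auto simp: simplex_map_def)
  then have z: "antipodal_cycle 0 (octa_chain 0) = frag_of (\<lambda>u\<in>standard_simplex 0. basis_point 0)
      - frag_of (\<lambda>u\<in>standard_simplex 0. antipode (basis_point 0))"
    by (simp add: antipodal_cycle_def)
  show ?case
    using chain_boundary_simplicial_cone[OF simplicial_chain_antipodal_cycle[OF simplicial_chain_octa_chain[of 0]]]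
    unfolding octa_chain.simps(2) z by (simp add: frag_extend_diff)
next
  case (Suc p)
  let ?h = "octa_chain p"
  have sc: "singular_chain p (subtopology (powertop_real UNIV) (octa_sphere (Suc p))) (octa_chain p)"
    for p
    by (rule simplicial_imp_singular_chain[OF simplicial_chain_octa_chain])
  have inv: "chain_map p antipode (chain_map p antipode ?h) = ?h"
    using chain_map_id_gen[OF sc, where f = "antipode \<circ> antipode"] by (simp add: chain_map_compose)
  have "chain_boundary (Suc p) (antipodal_cycle (Suc p) (octa_chain (Suc p))) =
      antipodal_cycle p ?h + frag_cmul ((-1) ^ p) (chain_map p antipode (antipodal_cycle p ?h))"
    unfolding antipodal_cycle_def[of "Suc p"]
    by (simp del: octa_chain.simps add: chain_boundary_add chain_boundary_cmul Suc.IH chain_boundary_chain_map[OF sc])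
  also have "\<dots> = 0"
    by (cases "even p") (simp_all add: antipodal_cycle_def chain_map_add chain_map_diff inv frag_cmul_distrib2)
  finally have "chain_boundary (Suc p) (antipodal_cycle (Suc p) (octa_chain (Suc p))) = 0" .
  then show ?case
    using chain_boundary_simplicial_cone[OF simplicial_chain_antipodal_cycle[OF simplicial_chain_octa_chain[of "Suc p"]]]
    by (simp add: simplicial_cone_def)
qed

section \<open>Fan's lemma and the Borsuk-Ulam theorem\<close>

text \<open>Evaluation of a chain on an integer cochain. Only its parity matters below; integral
  coefficients fit the integral singular chains.\<close>

definition chain_eval :: "('s \<Rightarrow> int) \<Rightarrow> ('s \<Rightarrow>\<^sub>0 int) \<Rightarrow> int" where
  "chain_eval \<psi> c = (\<Sum>s\<in>Poly_Mapping.keys c. Poly_Mapping.lookup c s * \<psi> s)"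

lemma chain_eval_frag_extend:
  "chain_eval \<psi> c = Poly_Mapping.lookup (frag_extend (\<lambda>s. frag_cmul (\<psi> s) (frag_of ())) c) ()"
  by (simp add: chain_eval_def frag_extend_def Poly_Mapping.lookup_sum)

lemma chain_eval_0 [simp]: "chain_eval \<psi> 0 = 0"
  and chain_eval_of [simp]: "chain_eval \<psi> (frag_of s) = \<psi> s"
  by (simp_all add: chain_eval_def)

lemma chain_eval_add: "chain_eval \<psi> (a + b) = chain_eval \<psi> a + chain_eval \<psi> b"
  and chain_eval_diff: "chain_eval \<psi> (a - b) = chain_eval \<psi> a - chain_eval \<psi> b"
  and chain_eval_cmul: "chain_eval \<psi> (frag_cmul k a) = k * chain_eval \<psi> a"
  unfolding chain_eval_frag_extend
  by (simp_all add: frag_extend_add frag_extend_diff frag_extend_cmul lookup_add lookup_minus)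

lemma chain_eval_sum: "chain_eval \<psi> (sum c I) = (\<Sum>i\<in>I. chain_eval \<psi> (c i))"
  by (induction I rule: infinite_finite_induct) (simp_all add: chain_eval_add)

lemma chain_eval_plus: "chain_eval (\<lambda>s. \<psi> s + \<phi> s) c = chain_eval \<psi> c + chain_eval \<phi> c"
  by (simp add: chain_eval_def sum.distrib distrib_left)

lemma chain_eval_eq_0: "(\<And>s. s \<in> Poly_Mapping.keys c \<Longrightarrow> \<psi> s = 0) \<Longrightarrow> chain_eval \<psi> c = 0"
  by (simp add: chain_eval_def)

definition vertex_labels :: "('v \<Rightarrow> nat) \<Rightarrow> nat \<Rightarrow> ((nat \<Rightarrow> real) \<Rightarrow> 'v) \<Rightarrow> nat list" where
  "vertex_labels L p f = map (\<lambda>i. L (f (basis_point i))) [0..<Suc p]"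

lemma length_vertex_labels [simp]: "length (vertex_labels L p f) = Suc p"
  by (simp add: vertex_labels_def)

lemma basis_point_in_standard_simplex [simp]: "basis_point i \<in> standard_simplex p \<longleftrightarrow> i \<le> p"
  by (simp add: basis_point_def)

lemma vertex_labels_singular_face:
  assumes "k \<le> Suc p"
  shows "vertex_labels L p (singular_face (Suc p) k f) = delete_nth k (vertex_labels L (Suc p) f)"
proof (rule nth_equalityI)
  show "length (vertex_labels L p (singular_face (Suc p) k f))
      = length (delete_nth k (vertex_labels L (Suc p) f))"
    using assms by (simp add: delete_nth_def)
next
  fix i assume "i < length (vertex_labels L p (singular_face (Suc p) k f))"
  then have i: "i \<le> p" by simp
  have nth: "vertex_labels L q f' ! j = L (f' (basis_point j))" if "j \<le> q" for q j f'
    using that by (simp add: vertex_labels_def del: upt_Suc)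
  have "simplical_face k (basis_point i) = basis_point (if i < k then i else Suc i)"
    by (auto simp: simplical_face_def basis_point_def fun_eq_iff)
  then have "singular_face (Suc p) k f (basis_point i) = f (basis_point (if i < k then i else Suc i))"
    using i by (simp add: singular_face_def)
  then show "vertex_labels L p (singular_face (Suc p) k f) ! i
      = delete_nth k (vertex_labels L (Suc p) f) ! i"
    using i assms by (simp add: nth delete_nth_def nth_append min_def)
qed

text \<open>Fan's identity summed over a chain; modulo 2 the signs of the boundary disappear.\<close>

lemma fan_chain_boundary_parity:
  assumes "\<And>f. f \<in> Poly_Mapping.keys c \<Longrightarrow> uncomplemented (set (vertex_labels L (Suc p) f))"
  shows "even (chain_eval (\<lambda>f. fan (vertex_labels L p f)) (chain_boundary (Suc p) c)
    + chain_eval (\<lambda>f. fan (vertex_labels L (Suc p) f) + fan (map flip_label (vertex_labels L (Suc p) f))) c)"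
proof -
  have "Poly_Mapping.keys c \<subseteq> {f. uncomplemented (set (vertex_labels L (Suc p) f))}"
    using assms by blast
  then show ?thesis
  proof (induction c rule: frag_induction)
    case (one f)
    let ?l = "vertex_labels L (Suc p) f"
    define a where "a = (\<lambda>k. fan (delete_nth k ?l))"
    have "chain_eval (\<lambda>f. fan (vertex_labels L p f)) (chain_boundary (Suc p) (frag_of f))
        = (\<Sum>k\<le>Suc p. (-1) ^ k * a k)"
      by (simp add: chain_boundary_of chain_eval_sum chain_eval_cmul chain_eval_add
          vertex_labels_singular_face a_def)
    moreover have "even ((\<Sum>k\<le>Suc p. (-1) ^ k * a k) - (\<Sum>k\<le>Suc p. a k))"
    proof -
      have "even ((-1) ^ k * x - x)" for k and x :: int
        by (cases "even k") auto
      then show ?thesis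
        unfolding sum_subtractf[symmetric] by (intro dvd_sum)
    qed
    moreover have "even ((\<Sum>k\<le>Suc p. a k) + fan ?l + fan (map flip_label ?l))"
      using fan_facets_parity[of ?l] one by (simp add: a_def lessThan_Suc_atMost)
    ultimately show ?case
      by (simp add: chain_eval_of) presburger
  next
    case (diff a b)
    then show ?case
      by (simp add: chain_boundary_diff chain_eval_diff)
  qed simp
qed

lemma chain_eval_antipode:
  assumes "singular_chain p (subtopology X S) c"
    and flip: "\<And>x. x \<in> S \<Longrightarrow> L (antipode x) = flip_label (L x)"
  shows "chain_eval (\<lambda>f. fan (vertex_labels L p f)) (chain_map p antipode c)
    = chain_eval (\<lambda>f. fan (map flip_label (vertex_labels L p f))) c"
proof -
  have "Poly_Mapping.keys c \<subseteq> {f. f ` standard_simplex p \<subseteq> S}"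
    using assms(1) by (auto simp: singular_chain_subtopology)
  then show ?thesis
  proof (induction c rule: frag_induction)
    case (one f)
    have "vertex_labels L p (simplex_map p antipode f) = map flip_label (vertex_labels L p f)"
      using one by (auto simp: vertex_labels_def simplex_map_def flip image_subset_iff simp del: upt_Suc)
    then show ?case by simp
  next
    case (diff a b)
    then show ?case
      by (simp add: chain_map_diff chain_eval_diff)
  qed simp
qed

lemma singular_chain_iterated_subdivision:
  "singular_chain p X c \<Longrightarrow> singular_chain p X ((singular_subdivision p ^^ r) c)"
  by (induction r) (simp_all add: singular_chain_singular_subdivision)

lemma chain_boundary_iterated_subdivision:
  assumes "singular_chain (Suc p) X c"
  shows "chain_boundary (Suc p) ((singular_subdivision (Suc p) ^^ r) c)
    = (singular_subdivision p ^^ r) (chain_boundary (Suc p) c)"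
  by (induction r)
    (simp_all add: chain_boundary_singular_subdivision[OF singular_chain_iterated_subdivision[OF assms]])

lemma antipodal_cycle_singular_subdivision:
  assumes "singular_chain p X c"
  shows "singular_subdivision p (antipodal_cycle p c) = antipodal_cycle p (singular_subdivision p c)"
  using assms
  by (simp add: antipodal_cycle_def singular_subdivision_add naturality_singular_subdivision[symmetric])
    (simp add: singular_subdivision_def frag_extend_cmul frag_extend_minus)

lemma antipodal_cycle_iterated_subdivision:
  assumes "singular_chain p X c"
  shows "(singular_subdivision p ^^ r) (antipodal_cycle p c)
    = antipodal_cycle p ((singular_subdivision p ^^ r) c)"
  by (induction r)
    (simp_all add: antipodal_cycle_singular_subdivision[OF singular_chain_iterated_subdivision[OF assms]])

lemma singular_subdivision_dim_0:
  assumes "singular_chain 0 X c"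
  shows "singular_subdivision 0 c = c"
  using assms unfolding singular_chain_def
proof (induction c rule: frag_induction)
  case (one f)
  then show ?case
    using singular_simplex_chain_map_id by (fastforce simp: singular_subdivision_def)
qed (simp_all add: singular_subdivision_diff)

lemma flip_label_flip_label [simp]: "flip_label (flip_label c) = c"
  by (auto simp: flip_label_def)

lemma uncomplemented_flip_label: "uncomplemented L \<Longrightarrow> uncomplemented (flip_label ` L)"
  by (auto simp: uncomplemented_def) 

text \<open>Take the hemispheres of all dimensions below \<open>n\<close> and subdivide them so finely that no
  simplex has complementary labels. Subdivision commutes with boundaries and with the antipodal map,
  so the subdivided hemisphere of dimension \<open>k + 1\<close> still has the equator of two antipodal
  hemispheres of dimension \<open>k\<close> as boundary. By Fan's identity the parity of the
  number of alternating simplices in a hemisphere and its antipode is the same in all dimensions.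
  It is odd in dimension 0, where exactly one of two antipodal points has a positive label. In
  dimension \<open>n - 1\<close> an alternating simplex needs \<open>n\<close> distinct absolute values, and so
  \<open>n \<le> m\<close>.\<close>

lemma Fan_lemma:
  fixes L :: "(nat \<Rightarrow> real) \<Rightarrow> nat" and n m :: nat
  defines "X \<equiv> subtopology (powertop_real UNIV) (octa_sphere n)"
  assumes "0 < n"
    and flip: "\<And>x. x \<in> octa_sphere n \<Longrightarrow> L (antipode x) = flip_label (L x)"
    and range: "\<And>x. x \<in> octa_sphere n \<Longrightarrow> L x < 2 * m"
    and nbhd: "\<And>x. x \<in> octa_sphere n \<Longrightarrow> \<exists>U. openin X U \<and> x \<in> U \<and> uncomplemented (L ` U)"
  shows "n \<le> m"
proof (rule ccontr)
  assume "\<not> n \<le> m"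
  then have "m < n" by simp
  have oct: "singular_chain k X (octa_chain k)" if "k < n" for k
    using singular_chain_mono[OF simplicial_imp_singular_chain[OF simplicial_chain_octa_chain]]
      octa_sphere_mono[of "Suc k" n] that by (simp add: X_def)
  have "\<exists>N. \<forall>r f. N \<le> r \<longrightarrow> f \<in> Poly_Mapping.keys ((singular_subdivision k ^^ r) (octa_chain k))
      \<longrightarrow> uncomplemented (set (vertex_labels L k f))" if kn: "k < n" for k
  proof -
    have "topspace X \<subseteq> \<Union>{U. openin X U \<and> uncomplemented (L ` U)}"
      using nbhd by (auto simp: X_def)
    then obtain N where N: "\<And>r f. N \<le> r \<Longrightarrow> f \<in> Poly_Mapping.keys ((singular_subdivision k ^^ r) (octa_chain k))
        \<Longrightarrow> \<exists>V\<in>{U. openin X U \<and> uncomplemented (L ` U)}. f \<in> standard_simplex k \<rightarrow> V"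
      using sufficient_iterated_singular_subdivision_exists[OF _ _ oct[OF kn],
          where \<C> = "{U. openin X U \<and> uncomplemented (L ` U)}"]
      by auto
    have "uncomplemented (set (vertex_labels L k f))"
      if rf: "N \<le> r" "f \<in> Poly_Mapping.keys ((singular_subdivision k ^^ r) (octa_chain k))" for r f
    proof -
      obtain V where V: "uncomplemented (L ` V)" "f \<in> standard_simplex k \<rightarrow> V"
        using N[OF rf] by blast
      have "set (vertex_labels L k f) \<subseteq> L ` V"
        using V(2) by (auto simp: vertex_labels_def simp del: upt_Suc)
      then show ?thesis
        using V(1) unfolding uncomplemented_def by blast
    qed
    then show ?thesis by blast
  qed
  then obtain N where N: "\<And>k r f. k < n \<Longrightarrow> N k \<le> r
      \<Longrightarrow> f \<in> Poly_Mapping.keys ((singular_subdivision k ^^ r) (octa_chain k))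
      \<Longrightarrow> uncomplemented (set (vertex_labels L k f))"
    by metis
  \<comment> \<open>One number of subdivisions that is large enough in every dimension.\<close>
  define r where "r = (\<Sum>k<n. N k)"
  define h where "h = (\<lambda>k. (singular_subdivision k ^^ r) (octa_chain k))"
  have h: "singular_chain k X (h k)" if "k < n" for k
    unfolding h_def by (intro singular_chain_iterated_subdivision oct that)
  have small: "uncomplemented (set (vertex_labels L k f))" if "k < n" "f \<in> Poly_Mapping.keys (h k)" for k f
    using N[of k r f] that member_le_sum[of k "{..<n}" N] by (simp add: h_def r_def)
  have bd: "chain_boundary (Suc k) (h (Suc k)) = antipodal_cycle k (h k)" if "Suc k < n" for k
    unfolding h_def using that
    by (subst chain_boundary_iterated_subdivision[OF oct])
      (simp_all add: chain_boundary_octa_chain antipodal_cycle_iterated_subdivision[OF oct] del: octa_chain.simps)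
  \<comment> \<open>Alternating simplices in the hemisphere and in its antipode together.\<close>
  define P where "P = (\<lambda>k. chain_eval (\<lambda>f. fan (vertex_labels L k f)
      + fan (map flip_label (vertex_labels L k f))) (h k))"
  have step: "even (P k + P (Suc k))" if "Suc k < n" for k
  proof -
    have "chain_eval (\<lambda>f. fan (vertex_labels L k f)) (antipodal_cycle k (h k))
        = chain_eval (\<lambda>f. fan (vertex_labels L k f)) (h k)
        + (-1) ^ Suc k * chain_eval (\<lambda>f. fan (map flip_label (vertex_labels L k f))) (h k)"
      using chain_eval_antipode[of k "powertop_real UNIV" "octa_sphere n" "h k" L, OF _ flip] h[of k] that
      unfolding antipodal_cycle_def X_def by (simp only: chain_eval_add chain_eval_cmul)
    then have "even (chain_eval (\<lambda>f. fan (vertex_labels L k f)) (antipodal_cycle k (h k)) + P k)"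
      unfolding P_def chain_eval_plus by (cases "even k") auto
    moreover have "even (chain_eval (\<lambda>f. fan (vertex_labels L k f)) (antipodal_cycle k (h k)) + P (Suc k))"
      unfolding P_def bd[OF that, symmetric]
      by (rule fan_chain_boundary_parity) (use small that in blast)
    ultimately show ?thesis by presburger
  qed
  have "h 0 = octa_chain 0"
  proof -
    have "(singular_subdivision 0 ^^ i) (octa_chain 0) = octa_chain 0" for i
      by (induction i) (simp_all only: funpow.simps id_apply comp_apply singular_subdivision_dim_0[OF oct[OF \<open>0 < n\<close>]])
    then show ?thesis by (simp only: h_def)
  qed
  then have "odd (P 0)"
    by (auto simp: P_def vertex_labels_def fan_def)
  moreover have "k < n \<Longrightarrow> even (P 0 + P k)" for k
  proof (induction k)
    case (Suc k)
    then show ?case using step[of k] by simp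
  qed simp
  moreover have "P (n - 1) = 0"
    unfolding P_def
  proof (rule chain_eval_eq_0)
    fix f assume f: "f \<in> Poly_Mapping.keys (h (n - 1))"
    have unc: "uncomplemented (set (vertex_labels L (n - 1) f))"
      using small[OF _ f] \<open>0 < n\<close> by simp
    have "f ` standard_simplex (n - 1) \<subseteq> octa_sphere n"
      using h[of "n - 1"] f \<open>0 < n\<close> by (auto simp: X_def singular_chain_subtopology)
    then have "set (vertex_labels L (n - 1) f) \<subseteq> {..<2 * m}"
      using range by (auto simp: vertex_labels_def image_subset_iff simp del: upt_Suc)
    moreover from this have "set (map flip_label (vertex_labels L (n - 1) f)) \<subseteq> {..<2 * m}"
      by (auto simp: flip_label_def elim!: evenE oddE) 
    ultimately show "fan (vertex_labels L (n - 1) f) + fan (map flip_label (vertex_labels L (n - 1) f)) = 0"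
      using fan_eq_0[of "vertex_labels L (n - 1) f" m]
        fan_eq_0[of "map flip_label (vertex_labels L (n - 1) f)" m]
        unc uncomplemented_flip_label[OF unc] \<open>m < n\<close> by simp
  qed
  ultimately show False
    using \<open>0 < n\<close> by (metis add.right_neutral diff_less zero_less_one)
qed

text \<open>The Borsuk-Ulam theorem: without a common zero, label \<open>x\<close> by a coordinate \<open>j\<close>
  for which \<open>\<bar>g j x\<bar>\<close> is maximal, with the sign of \<open>g j x\<close>. Complementary labels at
  two points mean that one function jumps between large values of opposite signs, which is
  impossible near a given point, so Fan's lemma applies.\<close>

theorem Borsuk_Ulam_octa_sphere:
  fixes g :: "nat \<Rightarrow> (nat \<Rightarrow> real) \<Rightarrow> real"
  assumes cont: "\<And>j. j < m \<Longrightarrow>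
      continuous_map (subtopology (powertop_real UNIV) (octa_sphere n)) euclideanreal (g j)"
    and odd: "\<And>j x. j < m \<Longrightarrow> x \<in> octa_sphere n \<Longrightarrow> g j (antipode x) = - g j x"
    and nz: "\<And>x. x \<in> octa_sphere n \<Longrightarrow> \<exists>j<m. g j x \<noteq> 0"
  shows "n \<le> m"
proof (cases "n = 0")
  case False
  let ?X = "subtopology (powertop_real UNIV) (octa_sphere n)"
  define dom where "dom = (\<lambda>x j. j < m \<and> (\<forall>i<m. \<bar>g i x\<bar> \<le> \<bar>g j x\<bar>))"
  \<comment> \<open>The choice depends on \<open>x\<close> only through \<open>dom x\<close>, so antipodal points get the same coordinate.\<close>
  define J where "J = (\<lambda>x. SOME j. dom x j)"
  define L where "L = (\<lambda>x. 2 * J x + of_bool (g (J x) x < 0))"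
  have J: "dom x (J x)" if "x \<in> octa_sphere n" for x
  proof -
    have fin: "finite ((\<lambda>i. \<bar>g i x\<bar>) ` {..<m})" "(\<lambda>i. \<bar>g i x\<bar>) ` {..<m} \<noteq> {}"
      using nz[OF that] by auto
    then obtain j where "j < m" "\<bar>g j x\<bar> = Max ((\<lambda>i. \<bar>g i x\<bar>) ` {..<m})"
      using Max_in[OF fin] by fastforce
    then have "dom x j"
      using fin by (simp add: dom_def)
    then show ?thesis
      unfolding J_def by (rule someI)
  qed
  have Jm: "J x < m" and Jmax: "\<And>i. i < m \<Longrightarrow> \<bar>g i x\<bar> \<le> \<bar>g (J x) x\<bar>" and Jnz: "g (J x) x \<noteq> 0"
    if "x \<in> octa_sphere n" for x
    using J[OF that] nz[OF that] by (auto simp: dom_def)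
  show ?thesis
  proof (rule Fan_lemma[of n L])
    show "0 < n" using False by simp
    show "L x < 2 * m" if "x \<in> octa_sphere n" for x
      using Jm[OF that] by (auto simp: L_def)
    show "L (antipode x) = flip_label (L x)" if x: "x \<in> octa_sphere n" for x
    proof -
      have "dom (antipode x) = dom x"
        using odd x by (auto simp: dom_def fun_eq_iff)
      then have "J (antipode x) = J x" by (simp add: J_def)
      then show ?thesis
        using odd[OF Jm[OF x] x] Jnz[OF x] by (auto simp: L_def flip_label_def)
    qed
    show "\<exists>U. openin ?X U \<and> x \<in> U \<and> uncomplemented (L ` U)" if x: "x \<in> octa_sphere n" for x
    proof -
      define e where "e = \<bar>g (J x) x\<bar> / 2"
      define U where "U = (\<Inter>j\<in>{..<m}. {y \<in> topspace ?X. g j y \<in> ball (g j x) e})"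
      have e: "e > 0" using Jnz[OF x] by (simp add: e_def)
      have "openin ?X U"
        unfolding U_def using Jm[OF x]
        by (intro openin_INT2 openin_continuous_map_preimage[OF cont]) auto
      moreover have "x \<in> U"
        using x e by (simp add: U_def)
      moreover have "uncomplemented (L ` U)"
      proof -
        have False if yz: "y \<in> U" "z \<in> U" "L z = flip_label (L y)" for y z
        proof -
          have close: "w \<in> octa_sphere n" "\<bar>g j x - g j w\<bar> < e" if "w \<in> U" "j < m" for w j
            using that by (auto simp: U_def dist_real_def)
          have yS: "y \<in> octa_sphere n" and zS: "z \<in> octa_sphere n"
            using close Jm[OF x] yz by blast+
          have big: "e < \<bar>g (J w) w\<bar>" if "w \<in> U" "w \<in> octa_sphere n" for w
            using close(2)[OF that(1) Jm[OF x]] Jmax[OF that(2) Jm[OF x]] unfolding e_def by linarith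
          \<comment> \<open>The halved code is the coordinate, and the parity of the code is the sign.\<close>
          have "L z div 2 = L y div 2" "even (L z) \<noteq> even (L y)"
            using yz(3) by simp_all
          then have "J z = J y" and "(g (J z) z < 0) \<noteq> (g (J y) y < 0)"
            by (auto simp: L_def of_bool_def split: if_splits)
          then show False
            using big[OF yz(1) yS] big[OF yz(2) zS] close(2)[OF yz(1) Jm[OF yS]] close(2)[OF yz(2) Jm[OF yS]]
            by (auto simp: abs_if split: if_splits)
        qed
        then show ?thesis
          by (metis imageE uncomplemented_def)
      qed
      ultimately show ?thesis by blast
    qed
  qed
qed simp

section \<open>The Krasnoselski genus through odd real functions\<close>

lemma symmetric_setD: "symmetric_set T \<Longrightarrow> f \<in> T \<Longrightarrow> antipode f \<in> T"
  unfolding symmetric_set_def by blast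

lemma symmetric_setI: "(\<And>f. f \<in> T \<Longrightarrow> antipode f \<in> T) \<Longrightarrow> symmetric_set T"
  unfolding symmetric_set_def by (force simp: image_iff)

text \<open>Normalizing an odd map into \<open>\<real>\<^sup>k\<close> without zeros makes it a map into the sphere, so
  the genus can be handled through real functions. Real functions can be extended and combined
  one by one, and the case \<open>k = 0\<close> covers exactly the empty set.\<close>

lemma genus_le_iff:
  fixes T :: "('i \<Rightarrow> real) set"
  shows "genus T \<le> enat k \<longleftrightarrow>
    (\<exists>\<phi>. (\<forall>j<k. continuous_map (subtopology (powertop_real UNIV) T) euclideanreal (\<phi> j)
                \<and> (\<forall>f\<in>T. \<phi> j (antipode f) = - \<phi> j f))
       \<and> (\<forall>f\<in>T. \<exists>j<k. \<phi> j f \<noteq> 0))"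
  (is "_ \<longleftrightarrow> (\<exists>\<phi>. ?odd \<phi> \<and> ?nz \<phi>)")
proof (cases "T = {}")
  case False
  let ?X = "subtopology (powertop_real UNIV) T"
  define S where "S = {k. k \<ge> 1 \<and> (\<exists>h. continuous_map ?X (nsphere (k - 1)) h \<and>
            (\<forall>f\<in>T. h (\<lambda>i. - f i) = (\<lambda>j. - h f j)))}"
  have gen: "genus T = Inf (enat ` S)"
    using False by (simp add: genus_def S_def)
  show ?thesis
  proof
    assume "genus T \<le> enat k"
    then have "S \<noteq> {}" using gen by (auto simp: Inf_enat_def)
    then have "genus T \<in> enat ` S"
      unfolding gen Inf_enat_def by (auto intro: LeastI)
    then obtain p where p: "p \<in> S" "p \<le> k"
      using \<open>genus T \<le> enat k\<close> by auto
    then obtain h where h: "continuous_map ?X (nsphere (p - 1)) h"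
      and odd: "\<And>f. f \<in> T \<Longrightarrow> h (antipode f) = antipode (h f)" and "p \<ge> 1"
      by (auto simp: S_def)
    have odd_h: "?odd (\<lambda>j f. h f j)"
      using h odd by (auto simp: nsphere continuous_map_in_subtopology continuous_map_componentwise_UNIV)
    have nz_h: "?nz (\<lambda>j f. h f j)"
    proof
      fix f assume "f \<in> T"
      then have "(\<Sum>i\<le>p - 1. (h f i)\<^sup>2) = 1"
        using h by (auto simp: nsphere continuous_map_in_subtopology)
      then obtain i where "i \<le> p - 1" "h f i \<noteq> 0"
        by (metis (no_types, lifting) atMost_iff power_zero_numeral sum.neutral zero_neq_one)
      then show "\<exists>j<k. h f j \<noteq> 0"
        using p \<open>p \<ge> 1\<close> by (intro exI[of _ i]) auto
    qed
    show "\<exists>\<phi>. ?odd \<phi> \<and> ?nz \<phi>"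
      by (rule exI[of "\<lambda>\<phi>. ?odd \<phi> \<and> ?nz \<phi>" "\<lambda>j f. h f j", OF conjI[OF odd_h nz_h]])
  next
    assume "\<exists>\<phi>. ?odd \<phi> \<and> ?nz \<phi>"
    then obtain \<phi> where odd: "?odd \<phi>" and nz: "?nz \<phi>" by blast
    have k: "k \<ge> 1" using False nz by force
    define r where "r = (\<lambda>f. sqrt (\<Sum>i<k. (\<phi> i f)\<^sup>2))"
    define h where "h = (\<lambda>f j. if j < k then \<phi> j f / r f else 0)"
    have r2: "(\<Sum>i<k. (\<phi> i f)\<^sup>2) > 0" if f: "f \<in> T" for f
    proof -
      obtain i where "i < k" "\<phi> i f \<noteq> 0" using nz f by blast
      then show ?thesis by (intro sum_pos2[of _ i]) auto
    qed
    have cont_\<phi>: "continuous_map ?X euclideanreal (\<phi> j)" if "j < k" for j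
      using odd that by simp
    have r_nz: "r f \<noteq> 0" if "f \<in> T" for f
      using r2[OF that] by (simp add: r_def)
    have cont_r: "continuous_map ?X euclideanreal r"
      unfolding r_def
      by (intro continuous_map_sqrt continuous_map_sum continuous_map_real_pow cont_\<phi>) auto
    have "continuous_map ?X euclideanreal (\<lambda>f. h f j)" for j
    proof (cases "j < k")
      case True
      then have "continuous_map ?X euclideanreal (\<lambda>f. \<phi> j f / r f)"
        by (intro continuous_map_real_divide cont_\<phi> cont_r) (simp_all add: r_nz)
      then show ?thesis using True by (simp add: h_def)
    qed (simp add: h_def)
    moreover have "(\<Sum>i\<le>k - 1. (h f i)\<^sup>2) = 1" if "f \<in> T" for f
    proof -
      have "{..k - 1} = {..<k}" using k by auto
      then have "(\<Sum>i\<le>k - 1. (h f i)\<^sup>2) = (\<Sum>i<k. (\<phi> i f)\<^sup>2 / (r f)\<^sup>2)"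
        by (simp add: h_def power_divide)
      also have "\<dots> = 1"
        using r2[OF that] by (simp add: r_def sum_nonneg flip: sum_divide_distrib)
      finally show ?thesis .
    qed
    ultimately have "continuous_map ?X (nsphere (k - 1)) h"
      using k by (auto simp: nsphere continuous_map_in_subtopology continuous_map_componentwise_UNIV h_def)
    moreover have "h (antipode f) = antipode (h f)" if "f \<in> T" for f
      using odd that by (auto simp: h_def r_def fun_eq_iff)
    ultimately have "k \<in> S"
      using k by (auto simp: S_def)
    then show "genus T \<le> enat k"
      unfolding gen by (intro Inf_lower) auto
  qed
qed (auto simp: genus_def)

lemma genus_leE:
  assumes "genus T \<le> enat k"
  obtains \<phi> where "\<And>j. j < k \<Longrightarrow> continuous_map (subtopology (powertop_real UNIV) T) euclideanreal (\<phi> j)"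
    and "\<And>j f. j < k \<Longrightarrow> f \<in> T \<Longrightarrow> \<phi> j (antipode f) = - \<phi> j f"
    and "\<And>f. f \<in> T \<Longrightarrow> \<exists>j<k. \<phi> j f \<noteq> 0"
  using assms unfolding genus_le_iff by blast

lemma genus_geI:
  assumes "\<And>m. genus T \<le> enat m \<Longrightarrow> k \<le> m"
  shows "enat k \<le> genus T"
  using assms by (cases "genus T") auto

lemma genus_ne: "enat k \<le> genus T \<Longrightarrow> 1 \<le> k \<Longrightarrow> T \<noteq> {}"
  by (auto simp: genus_def zero_enat_def)

text \<open>Equality in the triangle inequality.\<close>

lemma abs_sum_eq_imp_same_sign:
  fixes f :: "'b \<Rightarrow> real"
  assumes "finite A" "\<bar>\<Sum>x\<in>A. f x\<bar> = (\<Sum>x\<in>A. \<bar>f x\<bar>)" "x \<in> A" "y \<in> A"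
  shows "0 \<le> f x * f y"
proof (cases "(\<Sum>x\<in>A. f x) \<ge> 0")
  case True
  then have "(\<Sum>x\<in>A. \<bar>f x\<bar> - f x) = 0"
    using assms(2) by (simp add: sum_subtractf)
  then have "\<forall>x\<in>A. \<bar>f x\<bar> - f x = 0"
    using assms(1) by (subst (asm) sum_nonneg_eq_0_iff) auto
  then show ?thesis using assms(3,4) by (intro mult_nonneg_nonneg) force+
next
  case False
  then have "(\<Sum>x\<in>A. \<bar>f x\<bar> + f x) = 0"
    using assms(2) by (simp add: sum.distrib)
  then have "\<forall>x\<in>A. \<bar>f x\<bar> + f x = 0"
    using assms(1) by (subst (asm) sum_nonneg_eq_0_iff) auto
  then show ?thesis using assms(3,4) by (intro mult_nonpos_nonpos) force+
qed

lemma sum_eq_0_same_sign: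
  fixes f :: "'b \<Rightarrow> real"
  assumes "finite A" "(\<Sum>x\<in>A. f x) = 0" "\<And>x y. x \<in> A \<Longrightarrow> y \<in> A \<Longrightarrow> 0 \<le> f x * f y" "x \<in> A"
  shows "f x = 0"
proof -
  have "(\<Sum>y\<in>A. f x * f y) = 0"
    using assms(2) by (simp flip: sum_distrib_left)
  then have "f x * f x = 0"
    using assms by (subst (asm) sum_nonneg_eq_0_iff) auto
  then show ?thesis by simp
qed

section \<open>Energy, genus and eigenvalues on the unit sphere\<close>

locale signless_laplacian =
  fixes K :: "'a set set" and d :: int and dir :: direction
  assumes complex: "abstract_simplicial_complex K"
    and d_nonneg: "d \<ge> 0"
    and deg_pos: "\<sigma> \<in> faces K d \<Longrightarrow> deg dir K d \<sigma> > 0"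
begin

abbreviation "F \<equiv> faces K d"
abbreviation "R \<equiv> row_faces dir K d"
abbreviation "X \<equiv> unit_sphere dir K d"
abbreviation "I \<equiv> energy dir K d"

lemma finite_F [simp]: "finite F"
  and finite_R [simp]: "finite R"
  using complex by (auto intro: finite_faces finite_row_faces)

lemma antipode_unit_sphere: "f \<in> X \<Longrightarrow> antipode f \<in> X"
  by (auto simp: unit_sphere_def face_space_def deg_norm_def)

lemma energy_antipode [simp]: "I (antipode f) = I f"
  by (simp add: energy_def inc_apply_def sum_negf)

lemma energy_nonneg: "0 \<le> I f"
  by (simp add: energy_def sum_nonneg)

lemma energy_le_1: "f \<in> X \<Longrightarrow> I f \<le> 1"
  using energy_le_deg_norm[OF complex d_nonneg, of dir f] by (simp add: unit_sphere_def)

lemma deg_norm_eq: "deg_norm dir K d f = (\<Sum>\<rho>\<in>R. \<Sum>\<sigma>\<in>F. \<bar>incidence dir \<rho> \<sigma> * f \<sigma>\<bar>)"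
proof -
  have "deg_norm dir K d f = (\<Sum>\<sigma>\<in>F. \<Sum>\<rho>\<in>R. \<bar>incidence dir \<rho> \<sigma> * f \<sigma>\<bar>)"
    unfolding deg_norm_def
    by (intro sum.cong) (simp_all add: abs_mult incidence_nonneg
        column_sum[OF complex d_nonneg] flip: sum_distrib_right)
  then show ?thesis by (simp add: sum.swap[of _ R F])
qed

text \<open>On the unit sphere \<open>1 - I f\<close> is the sum over the rows of the defects in the triangle
  inequality, so it vanishes iff every row attains equality.\<close>

lemma energy_eq_1_iff:
  assumes "f \<in> X"
  shows "I f = 1 \<longleftrightarrow>
    (\<forall>\<rho>\<in>R. \<bar>\<Sum>\<sigma>\<in>F. incidence dir \<rho> \<sigma> * f \<sigma>\<bar> = (\<Sum>\<sigma>\<in>F. \<bar>incidence dir \<rho> \<sigma> * f \<sigma>\<bar>))"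
proof -
  let ?D = "\<lambda>\<rho>. (\<Sum>\<sigma>\<in>F. \<bar>incidence dir \<rho> \<sigma> * f \<sigma>\<bar>) - \<bar>\<Sum>\<sigma>\<in>F. incidence dir \<rho> \<sigma> * f \<sigma>\<bar>"
  have "1 - I f = (\<Sum>\<rho>\<in>R. ?D \<rho>)"
    using assms deg_norm_eq[of f] by (simp add: unit_sphere_def energy_def inc_apply_def sum_subtractf)
  then have "I f = 1 \<longleftrightarrow> (\<Sum>\<rho>\<in>R. ?D \<rho>) = 0"
    by linarith
  also have "\<dots> \<longleftrightarrow> (\<forall>\<rho>\<in>R. ?D \<rho> = 0)"
    by (rule sum_nonneg_eq_0_iff) (simp_all add: sum_abs)
  also have "\<dots> \<longleftrightarrow> (\<forall>\<rho>\<in>R. \<bar>\<Sum>\<sigma>\<in>F. incidence dir \<rho> \<sigma> * f \<sigma>\<bar> = (\<Sum>\<sigma>\<in>F. \<bar>incidence dir \<rho> \<sigma> * f \<sigma>\<bar>))"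
    by (intro ball_cong refl) linarith
  finally show ?thesis .
qed

lemma adjacent_iff:
  "adjacent dir K d \<sigma> \<tau> \<longleftrightarrow> \<sigma> \<in> F \<and> \<tau> \<in> F \<and> \<sigma> \<noteq> \<tau> \<and>
    (\<exists>\<rho>\<in>R. incidence dir \<rho> \<sigma> = 1 \<and> incidence dir \<rho> \<tau> = 1)"
  by (cases dir) auto

lemma incidence_cases: "incidence dir \<rho> \<sigma> = 0 \<or> incidence dir \<rho> \<sigma> = 1"
  by (cases dir) auto

lemma adjacent_same_sign:
  assumes "f \<in> X" "I f = 1" "adjacent dir K d \<sigma> \<tau>"
  shows "0 \<le> f \<sigma> * f \<tau>"
proof -
  obtain \<rho> where \<rho>: "\<rho> \<in> R" "incidence dir \<rho> \<sigma> = 1" "incidence dir \<rho> \<tau> = 1" and "\<sigma> \<in> F" "\<tau> \<in> F"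
    using assms(3) by (auto simp: adjacent_iff)
  then have "0 \<le> (incidence dir \<rho> \<sigma> * f \<sigma>) * (incidence dir \<rho> \<tau> * f \<tau>)"
    using assms(1,2) by (intro abs_sum_eq_imp_same_sign[of F]) (auto simp: energy_eq_1_iff)
  then show ?thesis using \<rho> by simp
qed

text \<open>Two faces in a common row are adjacent, so a row meets an independent set at most once and its
  sum has at most one nonzero summand.\<close>

lemma energy_eq_1_on_independent:
  assumes "f \<in> X" and A: "A \<subseteq> F" "pairwise (\<lambda>\<sigma> \<tau>. \<not> adjacent dir K d \<sigma> \<tau>) A"
    and supp: "\<And>\<sigma>. \<sigma> \<in> F - A \<Longrightarrow> f \<sigma> = 0"
  shows "I f = 1"
  unfolding energy_eq_1_iff[OF assms(1)]
proof
  fix \<rho> assume \<rho>: "\<rho> \<in> R"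
  let ?a = "\<lambda>\<sigma>. incidence dir \<rho> \<sigma> * f \<sigma>"
  show "\<bar>\<Sum>\<sigma>\<in>F. ?a \<sigma>\<bar> = (\<Sum>\<sigma>\<in>F. \<bar>?a \<sigma>\<bar>)"
  proof (cases "\<exists>\<sigma>\<in>A. incidence dir \<rho> \<sigma> = 1")
    case True
    then obtain \<sigma> where \<sigma>: "\<sigma> \<in> A" "incidence dir \<rho> \<sigma> = 1" by blast
    have zero: "?a \<tau> = 0" if "\<tau> \<in> F - {\<sigma>}" for \<tau>
    proof (cases "\<tau> \<in> A")
      case True
      then have "incidence dir \<rho> \<tau> \<noteq> 1"
        using pairwiseD[OF A(2) \<sigma>(1) True] A(1) \<sigma> \<rho> that unfolding adjacent_iff by blast
      then show ?thesis using incidence_cases[of \<rho> \<tau>] by simp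
    qed (use supp that in auto)
    have "(\<Sum>\<tau>\<in>F. u \<tau>) = u \<sigma>" if "\<And>\<tau>. \<tau> \<in> F - {\<sigma>} \<Longrightarrow> u \<tau> = 0" for u :: "'a set \<Rightarrow> real"
      using sum.mono_neutral_right[of F "{\<sigma>}" u] \<sigma>(1) A(1) that by auto
    from this[of ?a] this[of "\<lambda>\<tau>. \<bar>?a \<tau>\<bar>"] show ?thesis
      using zero by simp
  next
    case False
    then have "?a \<sigma> = 0" if "\<sigma> \<in> F" for \<sigma>
      using supp that incidence_cases[of \<rho> \<sigma>] by (cases "\<sigma> \<in> A") auto
    then have "(\<Sum>\<sigma>\<in>F. ?a \<sigma>) = 0" "(\<Sum>\<sigma>\<in>F. \<bar>?a \<sigma>\<bar>) = 0"
      by (intro sum.neutral; simp)+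
    then show ?thesis by simp
  qed
qed

lemma continuous_energy: "continuous_map (powertop_real UNIV) euclideanreal I"
  unfolding energy_def inc_apply_def
  by (intro continuous_map_sum continuous_map_real_abs continuous_map_real_mult_left
      continuous_map_product_projection) auto

lemma compactin_unit_sphere: "compactin (powertop_real UNIV) X"
proof (rule closed_compactin)
  let ?B = "\<Pi>\<^sub>E \<sigma>\<in>UNIV. (if \<sigma> \<in> F then {- 1 / deg dir K d \<sigma> .. 1 / deg dir K d \<sigma>} else {0::real})"
  show "compactin (powertop_real UNIV) ?B"
    by (simp add: compactin_PiE)
  show "X \<subseteq> ?B"
  proof
    fix f assume f: "f \<in> X"
    have "\<bar>f \<sigma>\<bar> \<le> 1 / deg dir K d \<sigma>" if \<sigma>: "\<sigma> \<in> F" for \<sigma>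
    proof -
      have "deg dir K d \<sigma> * \<bar>f \<sigma>\<bar> \<le> (\<Sum>\<sigma>\<in>F. deg dir K d \<sigma> * \<bar>f \<sigma>\<bar>)"
        using \<sigma> deg_pos by (intro member_le_sum) (auto simp: less_imp_le)
      also have "\<dots> = 1" using f by (simp add: unit_sphere_def deg_norm_def)
      finally show ?thesis using deg_pos[OF \<sigma>] by (simp add: field_simps)
    qed
    then show "f \<in> ?B"
      using f by (fastforce simp: unit_sphere_def face_space_def abs_le_iff)
  qed
  have "X = (\<Inter>\<sigma>\<in>- F. {f \<in> topspace (powertop_real UNIV). f \<sigma> \<in> {0}})
      \<inter> {f \<in> topspace (powertop_real UNIV). deg_norm dir K d f \<in> {1}}"
    by (auto simp: unit_sphere_def face_space_def)
  moreover have "closedin (powertop_real UNIV) \<dots>"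
  proof -
    have norm: "closedin (powertop_real UNIV) {f \<in> topspace (powertop_real UNIV). deg_norm dir K d f \<in> {1}}"
      unfolding deg_norm_def
      by (intro closedin_continuous_map_preimage[where Y = euclideanreal] continuous_map_sum
          continuous_map_real_abs continuous_map_real_mult_left continuous_map_product_projection) auto
    have "closedin (powertop_real UNIV) {f \<in> topspace (powertop_real UNIV). f \<sigma> \<in> {0}}" for \<sigma> :: "'a set"
      by (intro closedin_continuous_map_preimage[where Y = euclideanreal]
          continuous_map_product_projection) auto
    then show ?thesis
      using norm by (cases "- F = {}") (auto intro!: closedin_Int closedin_Inter)
  qed
  ultimately show "closedin (powertop_real UNIV) X" by simp
qed

text \<open>Dividing coordinates by the degrees maps the cross-polytope boundary into the unit sphere of
  the weighted \<open>\<ell>\<^sup>1\<close> norm, and so Borsuk-Ulam bounds the genus of that sphere from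
  below.\<close>

lemma genus_unit_sphere:
  assumes "genus X \<le> enat m"
  shows "card F \<le> m"
proof -
  let ?P = "powertop_real UNIV"
  obtain \<phi> where cont: "\<And>j. j < m \<Longrightarrow> continuous_map (subtopology ?P X) euclideanreal (\<phi> j)"
    and odd: "\<And>j f. j < m \<Longrightarrow> f \<in> X \<Longrightarrow> \<phi> j (antipode f) = - \<phi> j f"
    and nz: "\<And>f. f \<in> X \<Longrightarrow> \<exists>j<m. \<phi> j f \<noteq> 0"
    using genus_leE[OF assms] by metis
  obtain b where b: "bij_betw b F {..<card F}"
    using ex_bij_betw_finite_nat[OF finite_F] by (auto simp: atLeast0LessThan)
  define E where "E = (\<lambda>(x :: nat \<Rightarrow> real) \<sigma>. if \<sigma> \<in> F then x (b \<sigma>) / deg dir K d \<sigma> else 0)"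
  have E: "E x \<in> X" if "x \<in> octa_sphere (card F)" for x
  proof -
    have "deg_norm dir K d (E x) = (\<Sum>\<sigma>\<in>F. \<bar>x (b \<sigma>)\<bar>)"
      unfolding deg_norm_def E_def using deg_pos
      by (intro sum.cong) (auto simp: less_imp_le less_imp_neq[symmetric])
    also have "\<dots> = 1"
      using sum.reindex_bij_betw[OF b, of "\<lambda>i. \<bar>x i\<bar>"] that by (simp add: octa_sphere_def)
    finally show ?thesis
      by (simp add: unit_sphere_def face_space_def E_def)
  qed
  have "continuous_map ?P euclideanreal (\<lambda>x. E x \<sigma>)" for \<sigma>
  proof (cases "\<sigma> \<in> F")
    case True
    have "continuous_map ?P euclideanreal (\<lambda>x :: nat \<Rightarrow> real. x (b \<sigma>) / deg dir K d \<sigma>)"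
      using deg_pos[OF True]
      by (intro continuous_map_real_divide continuous_map_product_projection) auto
    then show ?thesis using True by (simp add: E_def)
  qed (simp add: E_def)
  then have contE: "continuous_map (subtopology ?P (octa_sphere (card F))) (subtopology ?P X) E"
    using E by (auto simp: continuous_map_in_subtopology continuous_map_componentwise_UNIV
        intro: continuous_map_from_subtopology)
  have Eodd: "E (antipode x) = antipode (E x)" for x
    by (auto simp: E_def)
  show ?thesis
  proof (rule Borsuk_Ulam_octa_sphere)
    show "continuous_map (subtopology ?P (octa_sphere (card F))) euclideanreal (\<phi> j \<circ> E)" if "j < m" for j
      by (rule continuous_map_compose[OF contE cont[OF that]])
    show "(\<phi> j \<circ> E) (antipode x) = - (\<phi> j \<circ> E) x" if "j < m" "x \<in> octa_sphere (card F)" for j x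
      using that by (simp add: Eodd odd E)
    show "\<exists>j<m. (\<phi> j \<circ> E) x \<noteq> 0" if "x \<in> octa_sphere (card F)" for x
      using nz[OF E[OF that]] by simp
  qed
qed

lemma variational_eigenvalue_le:
  assumes "1 \<le> k" "T \<subseteq> X" "symmetric_set T" "enat k \<le> genus T" "\<And>f. f \<in> T \<Longrightarrow> I f \<le> c"
  shows "variational_eigenvalue dir K d k \<le> c"
  unfolding variational_eigenvalue_def
proof (rule cINF_lower2[where x = T])
  show "(SUP f\<in>T. I f) \<le> c"
    using assms genus_ne by (intro cSUP_least) auto
  show "bdd_below ((\<lambda>T. SUP f\<in>T. I f) ` {T. T \<subseteq> X \<and> symmetric_set T \<and> enat k \<le> genus T})"
  proof (rule bdd_belowI2)
    fix T assume T: "T \<in> {T. T \<subseteq> X \<and> symmetric_set T \<and> enat k \<le> genus T}"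
    then obtain f where "f \<in> T" using genus_ne assms(1) by blast
    then show "0 \<le> (SUP f\<in>T. I f)"
      using T energy_le_1 energy_nonneg by (intro cSUP_upper2[of _ _ f] bdd_aboveI2[of _ _ 1]) auto
  qed
qed (use assms in auto)

text \<open>The bound \<open>k \<le> card F\<close> makes the infimum range over a nonempty family: by Borsuk-Ulam the
  whole unit sphere belongs to it.\<close>

lemma variational_eigenvalue_ge:
  assumes "k \<le> card F"
    and "\<And>T. T \<subseteq> X \<Longrightarrow> symmetric_set T \<Longrightarrow> enat k \<le> genus T \<Longrightarrow> \<exists>f\<in>T. c \<le> I f"
  shows "c \<le> variational_eigenvalue dir K d k"
  unfolding variational_eigenvalue_def
proof (rule cINF_greatest)
  have "enat k \<le> genus X"
    using genus_unit_sphere assms(1) by (intro genus_geI) (meson le_trans)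
  then show "{T. T \<subseteq> X \<and> symmetric_set T \<and> enat k \<le> genus T} \<noteq> {}"
    using antipode_unit_sphere symmetric_setI by blast
  fix T assume T: "T \<in> {T. T \<subseteq> X \<and> symmetric_set T \<and> enat k \<le> genus T}"
  then obtain f where "f \<in> T" "c \<le> I f" using assms(2) by blast
  then show "c \<le> (SUP f\<in>T. I f)"
    using T energy_le_1 by (intro cSUP_upper2[of _ _ f] bdd_aboveI2[of _ _ 1]) auto
qed

text \<open>A symmetric set of genus more than \<open>card F - card A\<close> contains a point at which all
  \<open>card F - card A\<close> coordinates off \<open>A\<close> vanish, and there the energy is 1. Hence the last
  \<open>card A\<close> variational eigenvalues are at least 1; none exceeds 1.\<close>

lemma independent_le_variational_multiplicity:
  assumes A: "A \<subseteq> F" "pairwise (\<lambda>\<sigma> \<tau>. \<not> adjacent dir K d \<sigma> \<tau>) A"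
  shows "card A \<le> variational_multiplicity dir K d 1"
proof -
  have cardA: "card A \<le> card F"
    using A(1) by (intro card_mono) auto
  have "variational_eigenvalue dir K d k = 1" if k: "k \<in> {card F - card A + 1..card F}" for k
  proof (rule antisym)
    have "enat k \<le> genus X"
      using genus_unit_sphere k by (intro genus_geI) (meson atLeastAtMost_iff le_trans)
    then show "variational_eigenvalue dir K d k \<le> 1"
      using k energy_le_1 antipode_unit_sphere symmetric_setI
      by (intro variational_eigenvalue_le[of _ X]) auto
    show "1 \<le> variational_eigenvalue dir K d k"
    proof (rule variational_eigenvalue_ge)
      fix T assume T: "T \<subseteq> X" "symmetric_set T" "enat k \<le> genus T"
      have card: "card (F - A) = card F - card A"
        using A(1) by (intro card_Diff_subset) (auto intro: finite_subset)
      obtain b where b: "bij_betw b {..<card (F - A)} (F - A)"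
        using ex_bij_betw_nat_finite[of "F - A"] by (auto simp: atLeast0LessThan)
      have "\<exists>f\<in>T. \<forall>j<card F - card A. f (b j) = 0"
      proof (rule ccontr)
        assume no: "\<not> ?thesis"
        have "genus T \<le> enat (card F - card A)"
          unfolding genus_le_iff
        proof (intro exI[of _ "\<lambda>j f. f (b j)"] conjI allI impI ballI)
          show "continuous_map (subtopology (powertop_real UNIV) T) euclideanreal (\<lambda>f. f (b j))" for j
            by (intro continuous_map_from_subtopology continuous_map_product_projection) auto
          show "\<exists>j<card F - card A. f (b j) \<noteq> 0" if "f \<in> T" for f
            using no that by blast
        qed simp
        then show False
          using T(3) k by (metis Suc_eq_plus1 atLeastAtMost_iff enat_ord_simps(1) not_less_eq_eq order_trans)
      qed
      then obtain f where f: "f \<in> T" "\<And>j. j < card F - card A \<Longrightarrow> f (b j) = 0" by blast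
      have "f \<sigma> = 0" if "\<sigma> \<in> F - A" for \<sigma>
      proof -
        have "\<sigma> \<in> b ` {..<card (F - A)}" using b that by (simp add: bij_betw_def)
        then show ?thesis using f(2) card by auto
      qed
      then have "I f = 1"
        using f(1) T(1) by (intro energy_eq_1_on_independent[OF _ A]) auto
      then show "\<exists>f\<in>T. 1 \<le> I f" using f(1) by force
    qed (use k in simp)
  qed
  then have "{card F - card A + 1..card F}
      \<subseteq> {k \<in> {1..card F}. variational_eigenvalue dir K d k = 1}"
    by auto
  from card_mono[OF _ this] show ?thesis
    using cardA by (simp add: variational_multiplicity_def)
qed

text \<open>Tietze's theorem on the compact unit sphere, followed by taking the odd part.\<close>

lemma odd_extension:
  assumes "closedin (subtopology (powertop_real UNIV) X) M" "symmetric_set M"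
    and cont: "continuous_map (subtopology (powertop_real UNIV) M) euclideanreal \<phi>"
    and odd: "\<And>f. f \<in> M \<Longrightarrow> \<phi> (antipode f) = - \<phi> f"
  obtains \<psi> where "continuous_map (subtopology (powertop_real UNIV) X) euclideanreal \<psi>"
    "\<And>f. \<psi> (antipode f) = - \<psi> f" "\<And>f. f \<in> M \<Longrightarrow> \<psi> f = \<phi> f"
proof -
  let ?X = "subtopology (powertop_real UNIV) X"
  have "compact_space ?X"
    by (simp add: compact_space_subtopology compactin_unit_sphere)
  moreover have "Hausdorff_space ?X"
    by (intro Hausdorff_space_subtopology) (simp add: Hausdorff_space_product_topology)
  ultimately have "normal_space ?X"
    by (simp add: compact_Hausdorff_or_regular_imp_normal_space)
  moreover have "M \<subseteq> X"
    using closedin_subset[OF assms(1)] by simp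
  then have "continuous_map (subtopology ?X M) euclideanreal \<phi>"
    using cont by (simp add: subtopology_subtopology inf.absorb2)
  ultimately obtain \<xi> where \<xi>: "continuous_map ?X euclideanreal \<xi>" "\<And>f. f \<in> M \<Longrightarrow> \<xi> f = \<phi> f"
    using assms(1) unfolding normal_space_iff_Tietze by metis
  have "continuous_map ?X ?X antipode"
    using antipode_unit_sphere
    by (auto simp: continuous_map_in_subtopology continuous_map_componentwise_UNIV
        intro!: continuous_map_from_subtopology continuous_map_minus continuous_map_product_projection)
  from continuous_map_compose[OF this \<xi>(1)]
  have "continuous_map ?X euclideanreal (\<lambda>f. (\<xi> f - \<xi> (antipode f)) / 2)"
    using \<xi>(1) by (intro continuous_map_real_divide continuous_map_diff) (auto simp: o_def)
  moreover have "(\<xi> f - \<xi> (antipode f)) / 2 = \<phi> f" if "f \<in> M" for f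
    using \<xi>(2) that odd symmetric_setD[OF assms(2) that] by simp
  ultimately show thesis
    by (intro that[of "\<lambda>f. (\<xi> f - \<xi> (antipode f)) / 2"]) (auto simp: field_simps)
qed

text \<open>Odd functions \<open>\<psi> 0, \<dots>, \<psi> (m - 1)\<close> without common zero on the maximum set of the energy
  extend to the sphere. Their common zero set \<open>Z\<close> misses the maximum set, so by compactness the
  energy stays below some bound less than 1 on \<open>Z\<close>. The genus of \<open>Z\<close> is at least \<open>card F - m\<close>: if
  \<open>p\<close> odd functions have no common zero on \<open>Z\<close>, their extensions together with the \<open>\<psi> j\<close> are
  \<open>m + p\<close> functions without common zero on the sphere. So \<open>Z\<close> witnesses that the first
  \<open>card F - m\<close> variational eigenvalues are below 1.\<close>

lemma variational_multiplicity_le_genus: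
  assumes gen: "genus {f \<in> X. I f = 1} \<le> enat m"
  shows "variational_multiplicity dir K d 1 \<le> m"
proof -
  let ?X = "subtopology (powertop_real UNIV) X"
  define M where "M = {f \<in> X. I f = 1}"
  have contI: "continuous_map ?X euclideanreal I"
    by (intro continuous_map_from_subtopology continuous_energy)
  have closedM: "closedin ?X M"
    using closedin_continuous_map_preimage[OF contI, of "{1}"] by (simp add: M_def)
  have symM: "symmetric_set M"
    by (intro symmetric_setI) (simp add: M_def antipode_unit_sphere)
  obtain \<phi> where \<phi>: "\<And>j. j < m \<Longrightarrow> continuous_map (subtopology (powertop_real UNIV) M) euclideanreal (\<phi> j)"
      "\<And>j f. j < m \<Longrightarrow> f \<in> M \<Longrightarrow> \<phi> j (antipode f) = - \<phi> j f"
      "\<And>f. f \<in> M \<Longrightarrow> \<exists>j<m. \<phi> j f \<noteq> 0"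
    using genus_leE[OF gen[folded M_def]] by blast
  have "\<exists>\<psi>. continuous_map ?X euclideanreal \<psi> \<and> (\<forall>f. \<psi> (antipode f) = - \<psi> f)
      \<and> (\<forall>f\<in>M. \<psi> f = \<phi> j f)" if "j < m" for j
    using odd_extension[OF closedM symM \<phi>(1,2)[OF that]] by metis
  then obtain \<psi> where \<psi>: "\<And>j. j < m \<Longrightarrow> continuous_map ?X euclideanreal (\<psi> j)"
      "\<And>j f. j < m \<Longrightarrow> \<psi> j (antipode f) = - \<psi> j f"
      "\<And>j f. j < m \<Longrightarrow> f \<in> M \<Longrightarrow> \<psi> j f = \<phi> j f"
    by metis
  define Z where "Z = X \<inter> (\<Inter>j\<in>{..<m}. {f \<in> topspace ?X. \<psi> j f \<in> {0}})"
  have Z_iff: "f \<in> Z \<longleftrightarrow> f \<in> X \<and> (\<forall>j<m. \<psi> j f = 0)" for f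
    by (auto simp: Z_def)
  have closedZ: "closedin ?X Z"
  proof (cases "m = 0")
    case False
    have "closedin ?X (\<Inter>j\<in>{..<m}. {f \<in> topspace ?X. \<psi> j f \<in> {0}})"
      using False by (intro closedin_INT closedin_continuous_map_preimage[OF \<psi>(1)]) auto
    then show ?thesis
      using closedin_Int[OF closedin_topspace[of ?X]] by (simp add: Z_def)
  qed (use closedin_topspace[of ?X] in \<open>simp add: Z_def\<close>)
  have symZ: "symmetric_set Z"
    by (intro symmetric_setI) (simp add: Z_iff antipode_unit_sphere \<psi>(2))
  have genZ: "enat (card F - m) \<le> genus Z"
  proof (rule genus_geI)
    fix p assume "genus Z \<le> enat p"
    from genus_leE[OF this] obtain \<eta> where \<eta>: "\<And>j. j < p \<Longrightarrow> continuous_map (subtopology (powertop_real UNIV) Z) euclideanreal (\<eta> j)"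
        "\<And>j f. j < p \<Longrightarrow> f \<in> Z \<Longrightarrow> \<eta> j (antipode f) = - \<eta> j f"
        "\<And>f. f \<in> Z \<Longrightarrow> \<exists>j<p. \<eta> j f \<noteq> 0"
      by blast
    have "\<exists>\<theta>. continuous_map ?X euclideanreal \<theta> \<and> (\<forall>f. \<theta> (antipode f) = - \<theta> f)
        \<and> (\<forall>f\<in>Z. \<theta> f = \<eta> j f)" if "j < p" for j
      using odd_extension[OF closedZ symZ \<eta>(1,2)[OF that]] by metis
    then obtain \<theta> where \<theta>: "\<And>j. j < p \<Longrightarrow> continuous_map ?X euclideanreal (\<theta> j)"
        "\<And>j f. j < p \<Longrightarrow> \<theta> j (antipode f) = - \<theta> j f"
        "\<And>j f. j < p \<Longrightarrow> f \<in> Z \<Longrightarrow> \<theta> j f = \<eta> j f"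
      by metis
    define \<omega> where "\<omega> = (\<lambda>j. if j < m then \<psi> j else \<theta> (j - m))"
    have "genus X \<le> enat (m + p)"
      unfolding genus_le_iff
    proof (intro exI[of _ \<omega>] conjI allI impI ballI)
      fix f assume f: "f \<in> X"
      show "\<exists>j<m + p. \<omega> j f \<noteq> 0"
      proof (cases "f \<in> Z")
        case True
        then obtain j where "j < p" "\<eta> j f \<noteq> 0" using \<eta>(3) by blast
        then show ?thesis
          using \<theta>(3)[OF _ True] by (intro exI[of _ "m + j"]) (auto simp: \<omega>_def)
      next
        case False
        then obtain j where "j < m" "\<psi> j f \<noteq> 0" using f Z_iff by blast
        then show ?thesis by (intro exI[of _ j]) (auto simp: \<omega>_def)
      qed
    next
      fix j assume "j < m + p"
      then show "continuous_map ?X euclideanreal (\<omega> j)"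
        unfolding \<omega>_def using \<psi>(1)[of j] \<theta>(1)[of "j - m"] by simp
    next
      fix j f assume "j < m + p"
      then show "\<omega> j (antipode f) = - \<omega> j f"
        unfolding \<omega>_def using \<psi>(2)[of j f] \<theta>(2)[of "j - m" f] by simp
    qed
    then show "card F - m \<le> p" using genus_unit_sphere by fastforce
  qed
  have "variational_eigenvalue dir K d k < 1" if k: "1 \<le> k" "k \<le> card F - m" for k
  proof -
    have gk: "enat k \<le> genus Z"
      using k(2) genZ by (metis enat_ord_simps(1) order_trans)
    have "compactin ?X Z"
      using closedZ closedin_compact_space compactin_unit_sphere compact_space_subtopology by blast
    from image_compactin[OF this contI] have "compact (I ` Z)" by simp
    moreover have "I ` Z \<noteq> {}" using genus_ne[OF gk k(1)] by simp
    ultimately obtain f where f: "f \<in> Z" "\<And>g. g \<in> Z \<Longrightarrow> I g \<le> I f"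
      using compact_attains_sup[of "I ` Z"] by auto
    have "I f \<noteq> 1"
    proof
      assume "I f = 1"
      then have "f \<in> M" using f(1) Z_iff by (simp add: M_def)
      then show False using \<phi>(3) \<psi>(3) f(1) Z_iff by metis
    qed
    moreover have "variational_eigenvalue dir K d k \<le> I f"
      by (rule variational_eigenvalue_le[OF k(1) _ symZ gk f(2)]) (auto simp: Z_iff)
    ultimately show ?thesis
      using energy_le_1[of f] f(1) by (simp add: Z_iff)
  qed
  then have "{k \<in> {1..card F}. variational_eigenvalue dir K d k = 1} \<subseteq> {card F - m<..card F}"
    by force
  from card_mono[OF _ this] show ?thesis
    by (simp add: variational_multiplicity_def)
qed

text \<open>At a point of energy 1 all values on a clique have weakly the same sign, so their sum vanishes
  only if all of them do. The clique sums are therefore odd functions without common zero, because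
  the cliques cover all faces.\<close>

lemma genus_le_clique_cover:
  assumes C: "finite C" "\<And>Q. Q \<in> C \<Longrightarrow> face_clique dir K d Q" "\<Union>C = F"
  shows "genus {f \<in> X. I f = 1} \<le> enat (card C)"
proof -
  obtain b where b: "bij_betw b {..<card C} C"
    using ex_bij_betw_nat_finite[OF C(1)] by (auto simp: atLeast0LessThan)
  show ?thesis
    unfolding genus_le_iff
  proof (intro exI[of _ "\<lambda>j f. \<Sum>\<sigma>\<in>b j. f \<sigma>"] conjI allI impI ballI)
    fix j assume j: "j < card C"
    then have "b j \<in> C" using b by (auto simp: bij_betw_def)
    then have "b j \<subseteq> F" using C(3) by blast
    then have fin: "finite (b j)" by (rule finite_subset) simp
    show "continuous_map (subtopology (powertop_real UNIV) {f \<in> X. I f = 1}) euclideanreal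
        (\<lambda>f. \<Sum>\<sigma>\<in>b j. f \<sigma>)"
      using fin by (intro continuous_map_from_subtopology continuous_map_sum
          continuous_map_product_projection) auto
  next
    fix f assume f: "f \<in> {f \<in> X. I f = 1}"
    then obtain \<sigma> where \<sigma>: "\<sigma> \<in> F" "f \<sigma> \<noteq> 0"
      by (force simp: unit_sphere_def deg_norm_def intro: ccontr)
    then obtain Q where Q: "Q \<in> C" "\<sigma> \<in> Q" using C(3) by blast
    have clique: "face_clique dir K d Q" using C(2) Q(1) by blast
    have "(\<Sum>\<tau>\<in>Q. f \<tau>) \<noteq> 0"
    proof
      assume 0: "(\<Sum>\<tau>\<in>Q. f \<tau>) = 0"
      have "0 \<le> f \<tau> * f \<tau>'" if "\<tau> \<in> Q" "\<tau>' \<in> Q" for \<tau> \<tau>'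
        using adjacent_same_sign[of f \<tau> \<tau>'] f clique that
        by (cases "\<tau> = \<tau>'") (auto simp: face_clique_def pairwise_def)
      moreover have "finite Q"
        using clique by (auto simp: face_clique_def intro: finite_subset)
      ultimately show False
        using sum_eq_0_same_sign[OF _ 0 _ Q(2)] \<sigma>(2) by blast
    qed
    moreover obtain j where "j < card C" "b j = Q"
      using b Q(1) unfolding bij_betw_def by (metis imageE lessThan_iff)
    ultimately show "\<exists>j<card C. (\<Sum>\<sigma>\<in>b j. f \<sigma>) \<noteq> 0" by blast
  qed (simp add: sum_negf)
qed

end

theorem theorem4:
  fixes K :: "'a set set" and d :: int and dir :: direction and n :: nat
  assumes "abstract_simplicial_complex K"
    and "d \<ge> 0"
    and "n = card (faces K d)"
    and "n \<ge> 1"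
    and "\<forall>\<sigma>\<in>faces K d. deg dir K d \<sigma> > 0"
  shows "enat (independence_number dir K d) \<le> enat (variational_multiplicity dir K d 1) \<and>
    enat (variational_multiplicity dir K d 1) \<le> topological_multiplicity dir K d 1 \<and>
    topological_multiplicity dir K d 1 \<le> enat (clique_covering_number dir K d)"
proof (intro conjI)
  interpret signless_laplacian K d dir
    using assms by unfold_locales auto
  let ?A = "{A. A \<subseteq> faces K d \<and> pairwise (\<lambda>\<sigma> \<tau>. \<not> adjacent dir K d \<sigma> \<tau>) A}"
  have "finite ?A" by (rule finite_subset[of _ "Pow (faces K d)"]) auto
  moreover have "{} \<in> ?A" by simp
  ultimately have "Max (card ` ?A) \<in> card ` ?A"
    by (intro Max_in) blast+
  then show "enat (independence_number dir K d) \<le> enat (variational_multiplicity dir K d 1)"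
    unfolding independence_number_def using independent_le_variational_multiplicity by auto
  show "enat (variational_multiplicity dir K d 1) \<le> topological_multiplicity dir K d 1"
    unfolding topological_multiplicity_def
    by (intro genus_geI variational_multiplicity_le_genus)
  let ?cover = "\<lambda>m. \<exists>C. finite C \<and> card C = m \<and> (\<forall>Q\<in>C. face_clique dir K d Q) \<and> \<Union>C = faces K d"
  have "?cover (card ((\<lambda>\<sigma>. {\<sigma>}) ` faces K d))"
    by (intro exI[of _ "(\<lambda>\<sigma>. {\<sigma>}) ` faces K d"]) (auto simp: face_clique_def)
  then have "?cover (clique_covering_number dir K d)"
    unfolding clique_covering_number_def by (rule LeastI)
  then obtain C where C: "finite C" "card C = clique_covering_number dir K d"
      "\<And>Q. Q \<in> C \<Longrightarrow> face_clique dir K d Q" "\<Union>C = faces K d"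
    by (elim exE conjE) (rule that; (assumption | erule (1) bspec))
  show "topological_multiplicity dir K d 1 \<le> enat (clique_covering_number dir K d)"
    unfolding topological_multiplicity_def C(2)[symmetric] by (rule genus_le_clique_cover[OF C(1,3,4)])
qed

end
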